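(* Let $(n_j)_{j\ge1}$ be a strictly increasing unbounded sequence of positive real numbers, let $a_j>0$ for $j\ge1$, and set $A(x)=\sum_{n_j\le x}a_j$. Suppose that $A(x)=\rho x+O(x^{\beta})$ as $x\to\infty$ for some $\rho>0$ and $0\le\beta<1$. Let $f(s)=\sum_{j=1}^\infty a_jn_j^{-s}$ for $\operatorname{Re}s>1$, extended by analytic continuation to $\operatorname{Re}s>\beta$, $s\ne1$. (a) For every $\sigma>\frac{1+\beta}{2}$, $$\lim_{T\to\infty}\frac1T\int_0^T|f(\sigma+it)|^2\,dt=\sum_{j=1}^\infty\frac{a_j^2}{n_j^{2\sigma}},$$ where for $\sigma=1$ the integration starts at $t=1$ instead of $t=0$ (to avoid the pole). (b) For every $\delta>0$, uniformly for $\beta+\delta\le\sigma\le\frac{1+\beta}{2}$, $$\frac1T\int_0^T|f(\sigma+it)|^2\,dt\ll_\delta\frac{T^{\frac{1+\beta-2\sigma}{1-\beta}}-1}{1+\beta-2\sigma},$$ where the right-hand side is taken to be $\log T$ when $\sigma=\frac{1+\beta}{2}$. That is, the inequality holds for all sufficiently large $T$ with an implied constant that may depend on $\delta$ (and on the fixed data $(n_j),(a_j)$), but constant and threshold do not depend on $\sigma$ in the stated range.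
   Context: Under the hypothesis on $A$, the series $f(s)$ converges absolutely for $\operatorname{Re}s>1$, and $f(s)-\rho/(s-1)$ has an analytic continuation to the half-plane $\operatorname{Re}s>\beta$; $f$ denotes the continued function. *)

theory Defs
  imports "HOL-Complex_Analysis.Complex_Analysis" "HOL-Library.Landau_Symbols"
begin

text \<open>
  Sequences indexed by $j \ge 1$ are rendered as functions on \<open>nat\<close>, so \<open>n 0\<close>, \<open>a 0\<close>
  stand for $n_1$, $a_1$.
\<close>

definition counting_sum :: "(nat \<Rightarrow> real) \<Rightarrow> (nat \<Rightarrow> real) \<Rightarrow> real \<Rightarrow> real" where
  "counting_sum n a x = (\<Sum>j | n j \<le> x. a j)"

definition is_continuation ::
    "(nat \<Rightarrow> real) \<Rightarrow> (nat \<Rightarrow> real) \<Rightarrow> real \<Rightarrow> (complex \<Rightarrow> complex) \<Rightarrow> bool" where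
  "is_continuation n a \<beta> f \<longleftrightarrow>
     f holomorphic_on {s. Re s > \<beta>} - {1} \<and>
     (\<forall>s. Re s > 1 \<longrightarrow> (\<lambda>j. of_real (a j) * of_real (n j) powr (- s)) sums f s)"

text \<open>
  For $\beta < 1$ the region $\{\mathrm{Re}\, s > \beta\} \setminus \{1\}$ is connected, so the
  continuation is unique there; the choice operator leaves only the values outside the region
  unspecified. Its existence is not assumed.
\<close>

definition dirichlet_continuation ::
    "(nat \<Rightarrow> real) \<Rightarrow> (nat \<Rightarrow> real) \<Rightarrow> real \<Rightarrow> complex \<Rightarrow> complex" where
  "dirichlet_continuation n a \<beta> = (SOME f. is_continuation n a \<beta> f)"

end

theory Submission
  imports Defs
begin

text \<open>
  Put $\lambda_j = \log n_j$ and $T = 2\pi/h$, and cut the $\lambda$-axis into cells of length $h$. Within a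
  cell, Abel summation turns $e^{-it\lambda}$ into an average over $v \in [0,h]$ of sums
  $\sum_k c_k(v) e^{-itkh}$, which are orthogonal over $0 \le t \le T$. So the mean square over $[0,T]$ of a
  Dirichlet polynomial is bounded by the sum of the squared cell masses, and the tail
  $s \int_U^\infty R(x) e^{-sx}\,dx$ containing the remainder $R(x) = A(e^x) - \rho e^x$ is treated in the same
  way. Cutting at $U = \log T / (1-\beta)$, where the main term $h e^u$ of a cell mass balances its error
  $e^{\beta u}$, one finds that the mean square of $f(s) - \sum_{\lambda_j \le u_0} a_j n_j^{-s}$ is at most a
  constant times
  $\sum_{u_0 < \lambda_j \le U+1} a_j n_j^{\beta-2\sigma} + T^{(1+\beta-2\sigma)/(1-\beta)}$.
  Part (a) follows by letting $u_0 \to \infty$, part (b) from a fixed $u_0 < \lambda_1$.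
\<close>

subsection \<open>Mean squares of exponential sums\<close>

text \<open>The obstacle is that nothing is known about the spacing of the frequencies: the
  hypothesis controls only the mass in an interval, and there the error term dominates once the
  interval is short. Estimates that need separated frequencies do not apply. Lumping by cells
  replaces the frequencies by multiples of h, which have T = 2 pi / h as an exact common period. The
  price is a factor t \<le> T from Abel summation, that is T^2 in mean square; the Cauchy--Schwarz
  inequality in v and the length of the v-interval give back h^2, and T h = 2 pi.

  The choice of U means T = e^((1-\<beta>)U), and each contribution from beyond the cut, divided by
  T, is then at most a constant times e^((1+\<beta>-2\<sigma>)U). The integral of R, multiplied by
  s, has mean square of order T e^(2(\<beta>-\<sigma>)U). The main term beyond U continues to \<rho>
  e^((1-s)U)/(s-1); its square e^(2(1-\<sigma>)U) is larger by a factor T than what is wanted, but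
  the integral of 1/(1+t^2) is bounded, so the division by T restores the balance. The boundary
  value of R at U is smaller still. The integral to infinity is replaced by one up to a finite V,
  beyond which pointwise bounds suffice.\<close>

lemma integrable_on_bounded_measurable:
  fixes f :: "real \<Rightarrow> 'a :: euclidean_space"
  assumes "f \<in> borel_measurable borel" and "\<And>x. x \<in> {a..b} \<Longrightarrow> norm (f x) \<le> B"
  shows "f integrable_on {a..b}"
proof (rule measurable_bounded_by_integrable_imp_integrable)
  show "f \<in> borel_measurable (lebesgue_on {a..b})"
    using assms(1) by (simp add: borel_measurable_if_D lborelD measurable_completion measurable_restrict_space1)
  show "(\<lambda>_. B) integrable_on {a..b}" by (rule integrable_const_ivl)
qed (use assms in auto)

text \<open>The Cauchy--Schwarz inequality against the constant 1, obtained from the pointwise bound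
  |f| \<le> (c + |f|^2/c)/2 with a weight c > 0 that is chosen only after integration.\<close>

lemma square_integral_le:
  fixes f :: "real \<Rightarrow> complex"
  assumes h: "h > 0" and f: "f integrable_on {0..h}"
    and f2: "(\<lambda>x. (cmod (f x))\<^sup>2) integrable_on {0..h}"
  shows "(cmod (integral {0..h} f))\<^sup>2 \<le> h * integral {0..h} (\<lambda>x. (cmod (f x))\<^sup>2)"
proof -
  define I where "I = integral {0..h} (\<lambda>x. (cmod (f x))\<^sup>2)"
  define m where "m = cmod (integral {0..h} f)"
  have "m \<ge> 0" by (simp add: m_def)
  have key: "m \<le> (c * h + I / c) / 2" if c: "c > 0" for c
  proof -
    have "m \<le> integral {0..h} (\<lambda>x. (c + (cmod (f x))\<^sup>2 / c) / 2)"
      unfolding m_def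
    proof (rule integral_norm_bound_integral[OF f])
      show "(\<lambda>x. (c + (cmod (f x))\<^sup>2 / c) / 2) integrable_on {0..h}"
        by (intro integrable_on_divide integrable_add f2 integrable_const_ivl)
      fix x
      have "0 \<le> (c - cmod (f x))\<^sup>2" by simp
      then show "cmod (f x) \<le> (c + (cmod (f x))\<^sup>2 / c) / 2"
        using c by (simp add: field_simps power2_eq_square)
    qed
    also have "\<dots> = (c * h + I / c) / 2"
    proof -
      have "integral {0..h} (\<lambda>x. c + (cmod (f x))\<^sup>2 / c) = c * h + I / c"
        using h by (subst integral_add) (auto intro!: integrable_on_divide f2 simp: I_def)
      then show ?thesis by simp
    qed
    finally show ?thesis .
  qed
  show ?thesis
  proof (cases "m = 0")
    case True
    then show ?thesis using h by (auto simp: m_def intro!: mult_nonneg_nonneg integral_nonneg f2)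
  next
    case False
    then have "m > 0" using \<open>m \<ge> 0\<close> by simp
    \<comment> \<open>The weight c = m/h turns the term c h/2 into m/2, which the left side
      absorbs.\<close>
    with key[of "m / h"] h have "m \<le> (m + I * h / m) / 2" by (simp add: field_simps)
    then have "m\<^sup>2 \<le> h * I" using \<open>m > 0\<close> by (simp add: field_simps power2_eq_square)
    then show ?thesis by (simp add: m_def I_def)
  qed
qed

lemma norm_exp_sum_squared:
  fixes b \<phi> :: "nat \<Rightarrow> real"
  shows "(cmod (\<Sum>k<K. of_real (b k) * cis (- (t * \<phi> k))))\<^sup>2
    = (\<Sum>k<K. \<Sum>l<K. b k * b l * cos ((\<phi> k - \<phi> l) * t))"
proof -
  have "(cmod (\<Sum>k<K. of_real (b k) * cis (- (t * \<phi> k))))\<^sup>2 =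
     (\<Sum>k<K. b k * cos (t * \<phi> k))\<^sup>2 + (\<Sum>k<K. b k * sin (t * \<phi> k))\<^sup>2"
    unfolding cmod_power2 Re_sum Im_sum by (simp add: sum_negf)
  also have "\<dots> = (\<Sum>k<K. \<Sum>l<K. b k * b l *
       (cos (t * \<phi> k) * cos (t * \<phi> l) + sin (t * \<phi> k) * sin (t * \<phi> l)))"
    unfolding power2_eq_square sum_product sum.distrib[symmetric]
    by (intro sum.cong refl) (simp add: algebra_simps)
  also have "\<dots> = (\<Sum>k<K. \<Sum>l<K. b k * b l * cos ((\<phi> k - \<phi> l) * t))"
    unfolding cos_diff[symmetric] by (intro sum.cong refl) (simp add: algebra_simps)
  finally show ?thesis .
qed

text \<open>Every difference of frequencies is an integer multiple of h, so the interval consists of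
  whole periods and the off-diagonal terms vanish exactly, not merely in the limit.\<close>

lemma has_integral_cos_period:
  assumes h: "h > 0"
  shows "((\<lambda>t. cos ((real k * h - real l * h) * t)) has_integral (if k = l then 2 * pi / h else 0))
     {0..2 * pi / h}"
proof (cases "k = l")
  case True
  then show ?thesis using has_integral_const_real[of "1::real" 0 "2*pi/h"] h by simp
next
  case False
  define c where "c = real k * h - real l * h"
  have c: "c \<noteq> 0" using False h by (auto simp: c_def)
  have "((\<lambda>t. cos (c * t)) has_integral (sin (c * (2*pi/h)) / c - sin (c * 0) / c)) {0..2*pi/h}"
    using h c by (intro fundamental_theorem_of_calculus)
      (auto intro!: derivative_eq_intros simp: has_real_derivative_iff_has_vector_derivative[symmetric])
  moreover have "sin (c * (2*pi/h)) = sin (2 * pi * of_int (int k - int l))"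
    using h by (simp add: c_def algebra_simps)
  moreover have "sin (2 * pi * of_int (int k - int l)) = (0::real)"
    using sin_int_2pin by blast
  ultimately show ?thesis using False by (simp add: c_def)
qed

text \<open>The weights are arbitrary because two kinds occur later: products of cell masses, and
  integrals over v of products of coefficients.\<close>

lemma has_integral_norm_exp_sum_squared:
  fixes w :: "nat \<Rightarrow> nat \<Rightarrow> real"
  assumes "h > 0"
  shows "((\<lambda>t. \<Sum>k<K. \<Sum>l<K. w k l * cos ((real k * h - real l * h) * t))
     has_integral 2 * pi / h * (\<Sum>k<K. w k k)) {0..2 * pi / h}"
proof -
  have "((\<lambda>t. \<Sum>k<K. \<Sum>l<K. w k l * cos ((real k * h - real l * h) * t)) has_integral
     (\<Sum>k<K. \<Sum>l<K. w k l * (if k = l then 2 * pi / h else 0))) {0..2*pi/h}"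
    by (intro has_integral_sum has_integral_mult_right has_integral_cos_period assms finite_lessThan)
  also have "(\<Sum>k<K. \<Sum>l<K. w k l * (if k = l then 2 * pi / h else 0)) = 2 * pi / h * (\<Sum>k<K. w k k)"
    by (simp add: sum_distrib_left sum_distrib_right sum_divide_distrib if_distrib[of "\<lambda>x. _ * x"] mult.commute cong: if_cong)
  finally show ?thesis .
qed

text \<open>
  The majorant \<open>Y\<close> comes from the Cauchy--Schwarz inequality in $v$; expanding the square makes it a
  finite cosine sum in $t$, so no interchange of integrals is needed.
\<close>

lemma mean_square_periodized:
  fixes c :: "nat \<Rightarrow> real \<Rightarrow> real"
  assumes h: "h > 0"
    and meas: "\<And>k. k < K \<Longrightarrow> c k \<in> borel_measurable borel"
    and bd: "\<And>k v. k < K \<Longrightarrow> v \<in> {0..h} \<Longrightarrow> \<bar>c k v\<bar> \<le> d k"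
  obtains Y where "continuous_on UNIV Y"
    and "\<And>t. (cmod (integral {0..h} (\<lambda>v. cis (- (t * v)) * (\<Sum>k<K. of_real (c k v) * cis (- (t * (k * h)))))))\<^sup>2 \<le> Y t"
    and "integral {0..2 * pi / h} Y \<le> 2 * pi * h * (\<Sum>k<K. (d k)\<^sup>2)"
proof -
  define w where "w k l = integral {0..h} (\<lambda>v. c k v * c l v)" for k l
  define Y where "Y t = h * (\<Sum>k<K. \<Sum>l<K. w k l * cos ((real k * h - real l * h) * t))" for t
  have d0: "d k \<ge> 0" if "k < K" for k using bd[OF that, of 0] h by auto
  have cc: "(\<lambda>v. c k v * c l v) integrable_on {0..h}" if "k < K" "l < K" for k l
    using meas[OF that(1)] meas[OF that(2)] bd[OF that(1)] bd[OF that(2)] d0[OF that(1)]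
    by (intro integrable_on_bounded_measurable[where B = "d k * d l"])
       (auto simp: abs_mult intro!: mult_mono)
  show thesis
  proof
    show "continuous_on UNIV Y" unfolding Y_def by (intro continuous_intros)
  next
    fix t
    let ?f = "\<lambda>v. cis (- (t * v)) * (\<Sum>k<K. of_real (c k v) * cis (- (t * (k * h))))"
    have sq: "(\<lambda>v. (cmod (?f v))\<^sup>2) = (\<lambda>v. \<Sum>k<K. \<Sum>l<K. c k v * c l v * cos ((real k * h - real l * h) * t))"
      by (simp add: norm_mult norm_exp_sum_squared)
    have "(cmod (integral {0..h} ?f))\<^sup>2 \<le> h * integral {0..h} (\<lambda>v. (cmod (?f v))\<^sup>2)"
    proof (rule square_integral_le[OF h])
      have "norm (?f v) \<le> (\<Sum>k<K. d k)" if "v \<in> {0..h}" for v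
        unfolding norm_mult norm_cis mult_1_left
        by (rule sum_norm_le) (use bd that in \<open>auto simp: norm_mult\<close>)
      moreover have "?f \<in> borel_measurable borel"
        using meas by (intro borel_measurable_times borel_measurable_sum borel_measurable_of_real)
          (auto intro!: borel_measurable_continuous_onI continuous_intros)
      ultimately show "?f integrable_on {0..h}"
        by (intro integrable_on_bounded_measurable) auto
      show "(\<lambda>v. (cmod (?f v))\<^sup>2) integrable_on {0..h}"
        unfolding sq by (intro integrable_sum integrable_on_mult_left cc) auto
    qed
    also have "integral {0..h} (\<lambda>v. (cmod (?f v))\<^sup>2) =
        (\<Sum>k<K. \<Sum>l<K. w k l * cos ((real k * h - real l * h) * t))"
      unfolding sq w_def
      by (subst integral_sum, simp, intro integrable_sum integrable_on_mult_left cc, simp, simp, simp,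
          intro sum.cong refl, subst integral_sum, simp, intro integrable_on_mult_left cc, simp, simp)
         (simp add: mult.commute)
    finally show "(cmod (integral {0..h} ?f))\<^sup>2 \<le> Y t" by (simp add: Y_def)
  next
    have "(Y has_integral (h * (2 * pi / h * (\<Sum>k<K. w k k)))) {0..2 * pi / h}"
      unfolding Y_def by (intro has_integral_mult_right has_integral_norm_exp_sum_squared h)
    then have "integral {0..2 * pi / h} Y = 2 * pi * (\<Sum>k<K. w k k)"
      using h by (simp add: integral_unique)
    \<comment> \<open>Only the diagonal has survived. The factor h from the Cauchy--Schwarz
      inequality has cancelled against the period 2 pi / h; the h gained here, the length of the
      v-interval, is the one in the final bound.\<close>
    also have "(\<Sum>k<K. w k k) \<le> (\<Sum>k<K. h * (d k)\<^sup>2)"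
    proof (rule sum_mono)
      fix k assume k: "k \<in> {..<K}"
      have "w k k \<le> integral {0..h} (\<lambda>v. (d k)\<^sup>2)"
        unfolding w_def
      proof (rule integral_le)
        fix v assume "v \<in> {0..h}"
        then have "\<bar>c k v\<bar> \<le> \<bar>d k\<bar>" using bd[of k v] k d0[of k] by auto
        then show "c k v * c k v \<le> (d k)\<^sup>2" by (metis abs_le_square_iff power2_eq_square)
      qed (use cc k in auto)
      then show "w k k \<le> h * (d k)\<^sup>2" using h by simp
    qed
    finally show "integral {0..2 * pi / h} Y \<le> 2 * pi * h * (\<Sum>k<K. (d k)\<^sup>2)"
      by (simp add: sum_distrib_left mult.assoc)
  qed
qed

text \<open>The full geometric series is 1/(1 - e^(-y)), and e^y \<ge> 1 + y bounds it, uniformly in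
  K. With y proportional to h, multiplication by h leaves a quantity that stays bounded as h tends
  to 0.\<close>

lemma sum_exp_neg_le:
  fixes y :: real assumes y: "y > 0"
  shows "(\<Sum>k<K. exp (- (y * real k))) \<le> 1 + 1 / y"
proof -
  define q where "q = exp (- y)"
  have q: "q < 1" "q \<ge> 0" using y by (auto simp: q_def)
  have "exp y \<ge> 1 + y" by (rule exp_ge_add_one_self)
  then have "q \<le> 1 / (1 + y)" using y by (simp add: q_def exp_minus field_simps)
  moreover have "y / (1 + y) = 1 - 1 / (1 + y)" using y by (simp add: field_simps)
  ultimately have 1: "1 - q \<ge> y / (1 + y)" by linarith
  have "(\<Sum>k<K. exp (- (y * real k))) = (\<Sum>k<K. q ^ k)"
    by (simp add: q_def exp_of_nat_mult[symmetric] mult.commute)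
  also have "\<dots> = (1 - q ^ K) / (1 - q)" using q by (simp add: sum_gp_strict)
  also have "\<dots> \<le> 1 / (1 - q)" using q by (simp add: divide_right_mono)
  also have "\<dots> \<le> 1 / (y / (1 + y))" using 1 y q by (intro divide_left_mono) (auto intro!: mult_pos_pos)
  finally show ?thesis using y by (simp add: add_divide_distrib)
qed

lemma power2_sum_le_double: "(x + y)\<^sup>2 \<le> 2 * x\<^sup>2 + 2 * (y::real)\<^sup>2"
  using zero_le_power2[of "x - y"] by (simp add: power2_eq_square algebra_simps)

text \<open>Abel summation in integral form. The offset \<phi> now enters only through an indicator
  function of v, so summing over the points of a cell affects real coefficients alone and the
  oscillating factor becomes common to all of them.\<close>

lemma cis_interval_integral:
  obtains W where "\<And>\<phi>. 0 \<le> \<phi> \<Longrightarrow> \<phi> \<le> h \<Longrightarrow>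
      ((\<lambda>v. cis (- (t * v)) * of_real (if v \<le> \<phi> then 1 else 0)) has_integral W \<phi>) {0..h}"
    and "\<And>\<phi>. 0 \<le> \<phi> \<Longrightarrow> \<phi> \<le> h \<Longrightarrow> cis (- (t * \<phi>)) = 1 - \<i> * of_real t * W \<phi>"
proof
  define W where "W \<phi> = integral {0..\<phi>} (\<lambda>v. cis (- (t * v)))" for \<phi>
  fix \<phi> assume \<phi>: "0 \<le> \<phi>" "\<phi> \<le> h"
  have W: "((\<lambda>v. cis (- (t * v))) has_integral W \<phi>) {0..\<phi>}"
    unfolding W_def by (intro integrable_integral integrable_continuous_real continuous_intros)
  have "((\<lambda>v. if v \<in> {0..\<phi>} then cis (- (t * v)) else 0) has_integral W \<phi>) {0..h}"
    by (subst has_integral_restrict) (use W \<phi> in auto)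
  then show "((\<lambda>v. cis (- (t * v)) * of_real (if v \<le> \<phi> then 1 else 0)) has_integral W \<phi>) {0..h}"
    by (rule has_integral_eq[rotated]) auto
  have "((\<lambda>v. - \<i> * of_real t * cis (- (t * v))) has_integral - \<i> * of_real t * W \<phi>) {0..\<phi>}"
    by (intro has_integral_mult_right W)
  moreover have "((\<lambda>v. - \<i> * of_real t * cis (- (t * v))) has_integral (cis (- (t * \<phi>)) - cis (- (t * 0)))) {0..\<phi>}"
    using \<phi> unfolding cis_conv_exp by (intro fundamental_theorem_of_calculus)
      (auto intro!: derivative_eq_intros has_vector_derivative_real_field)
  ultimately have "- \<i> * of_real t * W \<phi> = cis (- (t * \<phi>)) - cis (- (t * 0))"
    by (rule has_integral_unique)
  then show "cis (- (t * \<phi>)) = 1 - \<i> * of_real t * W \<phi>" by (simp add: algebra_simps)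
qed

lemma integral_split_cells:
  fixes g :: "real \<Rightarrow> complex"
  assumes h: "h > 0" and int: "\<And>x y. x \<le> y \<Longrightarrow> g integrable_on {x..y}"
  shows "integral {u..u + real K * h} g = (\<Sum>k<K. integral {0..h} (\<lambda>v. g (u + real k * h + v)))"
proof (induction K)
  case (Suc K)
  have "integral {0..h} (\<lambda>v. g (u + real K * h + v)) = integral {u + K * h..u + K * h + h} g"
    using integral_shift_Icc_real[of 0 h g "u + K * h"] by (simp add: comp_def add_ac)
  moreover have "integral {u..u + real K * h} g + integral {u + K * h..u + K * h + h} g = integral {u..u + K * h + h} g"
    using h by (intro Henstock_Kurzweil_Integration.integral_combine int) auto
  ultimately show ?case using Suc by (simp add: algebra_simps)
qed simp

lemma exp_neg_Complex: "exp (- (Complex \<sigma> t * of_real x)) = of_real (exp (- (\<sigma> * x))) * cis (- (t * x))"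
  by (simp add: complex_eq_iff Re_exp Im_exp)

lemma power2_norm_sum4_le:
  fixes a b c d :: "'a :: real_normed_vector"
  shows "(norm (a + b + c + d))\<^sup>2 \<le> 4 * ((norm a)\<^sup>2 + (norm b)\<^sup>2 + (norm c)\<^sup>2 + (norm d)\<^sup>2)"
proof -
  have "norm (a + b + c + d) \<le> norm a + norm b + (norm c + norm d)"
    by (smt (verit) norm_triangle_ineq)
  then have "(norm (a + b + c + d))\<^sup>2 \<le> (norm a + norm b + (norm c + norm d))\<^sup>2"
    by (intro power_mono) auto
  also have "\<dots> \<le> 2 * (norm a + norm b)\<^sup>2 + 2 * (norm c + norm d)\<^sup>2"
    by (rule power2_sum_le_double)
  also have "\<dots> \<le> 2 * (2 * (norm a)\<^sup>2 + 2 * (norm b)\<^sup>2) + 2 * (2 * (norm c)\<^sup>2 + 2 * (norm d)\<^sup>2)"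
    by (intro add_mono mult_left_mono power2_sum_le_double) auto
  finally show ?thesis by simp
qed

text \<open>Majorant for the pole term: its total contribution stays bounded however long the
  interval is.\<close>

lemma integral_inverse_square_le:
  assumes "0 \<le> t0" "t0 \<le> T"
  shows "((\<lambda>t. inverse (1 + t\<^sup>2)) has_integral (arctan T - arctan t0)) {t0..T}"
    and "arctan T - arctan t0 \<le> 2"
proof -
  show "((\<lambda>t. inverse (1 + t\<^sup>2)) has_integral (arctan T - arctan t0)) {t0..T}"
    using assms by (intro fundamental_theorem_of_calculus)
      (auto intro!: derivative_eq_intros simp: has_real_derivative_iff_has_vector_derivative[symmetric])
  have "arctan t0 \<ge> 0" using assms by simp
  moreover have "arctan T < pi / 2" by (rule arctan_ubound)
  ultimately show "arctan T - arctan t0 \<le> 2" using pi_less_4 by linarith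
qed

text \<open>The cross term 2xy is split with a free parameter, by 0 \<le> (x - \<eta> y)^2/\<eta>. A
  mean square of p that is merely bounded then costs as little as desired, while the mean square of
  f - p may be multiplied by a large constant because it will be small.\<close>

lemma norm_square_diff_le:
  fixes f p :: "'a :: real_normed_vector"
  assumes \<eta>: "\<eta> > 0"
  shows "\<bar>(norm f)\<^sup>2 - (norm p)\<^sup>2\<bar> \<le> (1 + 1 / \<eta>) * (norm (f - p))\<^sup>2 + \<eta> * (norm p)\<^sup>2"
proof -
  define x y z where "x = norm (f - p)" and "y = norm p" and "z = norm f"
  have xyz: "x \<ge> 0" "y \<ge> 0" "z \<ge> 0" "z \<le> y + x" "\<bar>z - y\<bar> \<le> x"
    unfolding x_def y_def z_def using norm_triangle_sub[of f p] norm_triangle_ineq3[of f p] by auto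
  have "\<bar>z\<^sup>2 - y\<^sup>2\<bar> = \<bar>z - y\<bar> * (z + y)"
    using xyz by (simp add: power2_eq_square square_diff_square_factored abs_mult)
  also have "\<dots> \<le> x * (2 * y + x)" using xyz by (intro mult_mono) auto
  also have "\<dots> \<le> (1 + 1 / \<eta>) * x\<^sup>2 + \<eta> * y\<^sup>2"
  proof -
    have "0 \<le> (x - \<eta> * y)\<^sup>2 / \<eta>" using \<eta> by simp
    also have "(x - \<eta> * y)\<^sup>2 / \<eta> = x\<^sup>2 / \<eta> - 2 * x * y + \<eta> * y\<^sup>2"
      using \<eta> by (simp add: power2_eq_square field_simps)
    finally show ?thesis by (simp add: power2_eq_square algebra_simps)
  qed
  finally show ?thesis by (simp add: x_def y_def z_def)
qed

text \<open>Off-diagonal cosines have bounded primitives, so division by T removes them. No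
  uniformity in K is claimed: the sum is fixed before T grows, and the starting point
  \<open>t0\<close> changes the diagonal only by \<open>t0\<close>/T.\<close>

lemma mean_square_exp_sum:
  fixes b \<phi> :: "nat \<Rightarrow> real"
  assumes inj: "inj \<phi>"
  shows "((\<lambda>T. 1 / T * integral {t0..T} (\<lambda>t. (cmod (\<Sum>k<K. of_real (b k) * cis (- (t * \<phi> k))))\<^sup>2))
    \<longlongrightarrow> (\<Sum>k<K. (b k)\<^sup>2)) at_top"
proof -
  define c where "c k l T = (if k = l then T - t0 else (sin ((\<phi> k - \<phi> l) * T) - sin ((\<phi> k - \<phi> l) * t0)) / (\<phi> k - \<phi> l))" for k l T
  have c_int: "((\<lambda>t. cos ((\<phi> k - \<phi> l) * t)) has_integral c k l T) {t0..T}" if "t0 \<le> T" for k l T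
  proof (cases "k = l")
    case True
    then show ?thesis using has_integral_const_real[of "1::real" t0 T] that by (simp add: c_def)
  next
    case False
    then have "\<phi> k - \<phi> l \<noteq> 0" using inj by (auto dest: injD)
    then have "((\<lambda>t. cos ((\<phi> k - \<phi> l) * t)) has_integral
        (sin ((\<phi> k - \<phi> l) * T) / (\<phi> k - \<phi> l) - sin ((\<phi> k - \<phi> l) * t0) / (\<phi> k - \<phi> l))) {t0..T}"
      using that by (intro fundamental_theorem_of_calculus)
        (auto intro!: derivative_eq_intros simp: has_real_derivative_iff_has_vector_derivative[symmetric])
    then show ?thesis using False by (simp add: c_def diff_divide_distrib)
  qed
  have inv: "((\<lambda>T. M * inverse T) \<longlongrightarrow> 0) at_top" for M :: real
    using tendsto_mult[OF tendsto_const tendsto_inverse_0_at_top[OF filterlim_ident]] by fastforce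
  have c_lim: "((\<lambda>T. 1 / T * c k l T) \<longlongrightarrow> (if k = l then 1 else 0)) at_top" for k l
  proof (cases "k = l")
    case True
    have "((\<lambda>T. 1 - t0 * inverse T) \<longlongrightarrow> 1 - 0) at_top" by (intro tendsto_diff tendsto_const inv)
    moreover have "\<forall>\<^sub>F T in at_top. 1 - t0 * inverse T = 1 / T * c k l T"
      using eventually_gt_at_top[of 0] by eventually_elim (simp add: c_def True field_simps)
    ultimately show ?thesis using True by (simp add: tendsto_cong)
  next
    case False
    have "((\<lambda>T. 1 / T * c k l T) \<longlongrightarrow> 0) at_top"
    proof (rule Lim_null_comparison[OF _ inv])
      show "\<forall>\<^sub>F T in at_top. norm (1 / T * c k l T) \<le> 2 / \<bar>\<phi> k - \<phi> l\<bar> * inverse T"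
        using eventually_gt_at_top[of 0]
      proof eventually_elim
        case (elim T)
        have "\<bar>sin ((\<phi> k - \<phi> l) * T) - sin ((\<phi> k - \<phi> l) * t0)\<bar> \<le> 2"
          using abs_sin_le_one[of "(\<phi> k - \<phi> l) * T"] abs_sin_le_one[of "(\<phi> k - \<phi> l) * t0"] by linarith
        then have "\<bar>c k l T\<bar> \<le> 2 / \<bar>\<phi> k - \<phi> l\<bar>"
          using False by (simp add: c_def divide_right_mono)
        then have "\<bar>c k l T\<bar> * inverse T \<le> 2 / \<bar>\<phi> k - \<phi> l\<bar> * inverse T"
          using elim by (intro mult_right_mono) auto
        then show ?case using elim by (simp add: abs_mult divide_inverse mult.commute)
      qed
    qed
    then show ?thesis using False by simp
  qed
  have "((\<lambda>T. \<Sum>k<K. \<Sum>l<K. b k * b l * (1 / T * c k l T))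
      \<longlongrightarrow> (\<Sum>k<K. \<Sum>l<K. b k * b l * (if k = l then 1 else 0))) at_top"
    by (intro tendsto_sum tendsto_mult tendsto_const c_lim)
  also have "(\<Sum>k<K. \<Sum>l<K. b k * b l * (if k = l then 1 else 0)) = (\<Sum>k<K. (b k)\<^sup>2)"
    by (simp add: if_distrib[of "\<lambda>x. _ * x"] power2_eq_square cong: if_cong)
  finally have lim: "((\<lambda>T. \<Sum>k<K. \<Sum>l<K. b k * b l * (1 / T * c k l T)) \<longlongrightarrow> (\<Sum>k<K. (b k)\<^sup>2)) at_top" .
  have "\<forall>\<^sub>F T in at_top. (\<Sum>k<K. \<Sum>l<K. b k * b l * (1 / T * c k l T))
     = 1 / T * integral {t0..T} (\<lambda>t. (cmod (\<Sum>k<K. of_real (b k) * cis (- (t * \<phi> k))))\<^sup>2)"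
    using eventually_ge_at_top[of t0]
  proof eventually_elim
    case (elim T)
    have "((\<lambda>t. \<Sum>k<K. \<Sum>l<K. b k * b l * cos ((\<phi> k - \<phi> l) * t)) has_integral
        (\<Sum>k<K. \<Sum>l<K. b k * b l * c k l T)) {t0..T}"
      by (intro has_integral_sum has_integral_mult_right c_int elim finite_lessThan)
    then show ?case
      unfolding norm_exp_sum_squared by (simp add: integral_unique sum_distrib_left sum_divide_distrib mult_ac)
  qed
  then show ?thesis using lim by (rule Lim_transform_eventually[rotated])
qed

subsection \<open>Exponential growth\<close>

lemma tendsto_exp_neg_mult:
  fixes c :: real assumes "c < 0"
  shows "((\<lambda>u. K * exp (c * u)) \<longlongrightarrow> 0) at_top"
proof -
  have "filterlim (\<lambda>u. c * u) at_bot at_top"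
    using assms by (intro filterlim_tendsto_neg_mult_at_bot[OF tendsto_const] filterlim_ident)
  then have "((\<lambda>u. K * exp (c * u)) \<longlongrightarrow> K * 0) at_top"
    by (intro tendsto_mult tendsto_const filterlim_compose[OF exp_at_bot])
  then show ?thesis by simp
qed

text \<open>This is the integral of e^(\<epsilon> y) over y from 0 to x. With \<epsilon> = 1 +
  \<beta> - 2 \<sigma> and x = ln T / (1 - \<beta>) it is the right side of part (b) for \<epsilon>
  > 0; the value at \<epsilon> = 0 is the limit, so estimates are uniform up to the end point
  \<sigma> = (1 + \<beta>)/2.\<close>

definition exp_growth :: "real \<Rightarrow> real \<Rightarrow> real" where
  "exp_growth \<epsilon> x = (if \<epsilon> = 0 then x else (exp (\<epsilon> * x) - 1) / \<epsilon>)"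

lemma exp_growth_add: "exp_growth \<epsilon> (x + y) = exp_growth \<epsilon> x + exp (\<epsilon> * x) * exp_growth \<epsilon> y"
  by (simp add: exp_growth_def distrib_left exp_add diff_divide_distrib[symmetric] add_divide_distrib[symmetric] algebra_simps)

lemma exp_growth_ge: "\<epsilon> \<ge> 0 \<Longrightarrow> exp_growth \<epsilon> x \<ge> x"
  using exp_ge_add_one_self[of "\<epsilon> * x"] by (simp add: exp_growth_def field_simps)

lemma exp_growth_le: "\<epsilon> \<ge> 0 \<Longrightarrow> exp_growth \<epsilon> x \<le> x * exp (\<epsilon> * x)"
proof (cases "\<epsilon> = 0")
  case False
  assume "\<epsilon> \<ge> 0"
  have "1 - \<epsilon> * x \<le> exp (- (\<epsilon> * x))" using exp_ge_add_one_self[of "- (\<epsilon> * x)"] by simp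
  then have "(1 - \<epsilon> * x) * exp (\<epsilon> * x) \<le> exp (- (\<epsilon> * x)) * exp (\<epsilon> * x)" by (rule mult_right_mono) simp
  then have "exp (\<epsilon> * x) - 1 \<le> \<epsilon> * (x * exp (\<epsilon> * x))" by (simp add: algebra_simps flip: exp_add)
  then show ?thesis using False \<open>\<epsilon> \<ge> 0\<close> by (simp add: exp_growth_def divide_le_eq mult.commute)
qed (simp add: exp_growth_def)

text \<open>By definition e^(\<epsilon> x) = 1 + \<epsilon> \<open>exp_growth \<epsilon> x\<close>,
  and x \<ge> 1 makes the 1 negligible. This lets the power of T in the remainder bound be absorbed
  without dividing by \<epsilon>.\<close>

lemma exp_le_exp_growth: "0 \<le> \<epsilon> \<Longrightarrow> \<epsilon> \<le> 1 \<Longrightarrow> 1 \<le> x \<Longrightarrow> exp (\<epsilon> * x) \<le> 2 * exp_growth \<epsilon> x"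
proof -
  assume \<epsilon>: "0 \<le> \<epsilon>" "\<epsilon> \<le> 1" "1 \<le> x"
  have 1: "1 \<le> exp_growth \<epsilon> x" using exp_growth_ge[OF \<epsilon>(1), of x] \<epsilon>(3) by linarith
  have "exp (\<epsilon> * x) = 1 + \<epsilon> * exp_growth \<epsilon> x" by (simp add: exp_growth_def)
  also have "\<epsilon> * exp_growth \<epsilon> x \<le> 1 * exp_growth \<epsilon> x" using \<epsilon> 1 by (intro mult_right_mono) auto
  finally show ?thesis using 1 by linarith
qed

text \<open>Comparison of a sum with an integral, the integral over a unit step being expressed by
  \<open>exp_growth_add\<close>.\<close>

lemma sum_exp_le_exp_growth:
  assumes "\<epsilon> \<ge> 0" shows "(\<Sum>m<K. exp (\<epsilon> * real m)) \<le> exp_growth \<epsilon> (real K)"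
proof (induction K)
  case (Suc K)
  have "exp (\<epsilon> * real K) * 1 \<le> exp (\<epsilon> * real K) * exp_growth \<epsilon> 1"
    using exp_growth_ge[OF assms, of 1] by (intro mult_left_mono) auto
  moreover have "exp_growth \<epsilon> (real (Suc K)) = exp_growth \<epsilon> (real K) + exp (\<epsilon> * real K) * exp_growth \<epsilon> 1"
    using exp_growth_add[of \<epsilon> "real K" 1] by (simp add: add.commute)
  ultimately show ?case using Suc unfolding sum.lessThan_Suc by linarith
qed (simp add: exp_growth_def)

lemma exp_growth_mono: "\<epsilon> \<ge> 0 \<Longrightarrow> x \<le> y \<Longrightarrow> exp_growth \<epsilon> x \<le> exp_growth \<epsilon> y"
  by (auto simp: exp_growth_def intro!: divide_right_mono mult_left_mono)

subsection \<open>Continuation of the Dirichlet series\<close>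

text \<open>The setting on the logarithmic scale, n_j = e^(\<open>lam j\<close>). The remainder
  bound is required for every real u, so no later estimate needs a threshold for u.\<close>

locale log_dirichlet =
  fixes lam a :: "nat \<Rightarrow> real" and \<rho> \<beta> C :: real
  assumes lam_mono: "strict_mono lam"
    and lam_unbounded: "\<not> bdd_above (range lam)"
    and a_pos: "a j > 0"
    and rho_pos: "\<rho> > 0"
    and beta: "0 \<le> \<beta>" "\<beta> < 1"
    and remainder_bound: "\<bar>(\<Sum>j | lam j \<le> u. a j) - \<rho> * exp u\<bar> \<le> C * exp (\<beta> * u)"
begin

definition A :: "real \<Rightarrow> real" where "A u = (\<Sum>j | lam j \<le> u. a j)"

definition R :: "real \<Rightarrow> real" where "R u = A u - \<rho> * exp u"

definition D :: "real \<Rightarrow> complex \<Rightarrow> complex" where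
  "D u s = (\<Sum>j | lam j \<le> u. of_real (a j) * exp (- (s * of_real (lam j))))"

text \<open>The second summand is, for Re s > 1, the integral of \<rho> e^x e^(-s x) over x > u: the
  tail of the series with its counting function replaced by the main term. In this closed form it
  makes sense for every s other than 1.\<close>

definition G :: "real \<Rightarrow> complex \<Rightarrow> complex" where
  "G u s = D u s + of_real \<rho> * exp ((1 - s) * of_real u) / (s - 1)"

definition F :: "complex \<Rightarrow> complex" where "F s = lim (\<lambda>k. G (real k) s)"

lemma finite_le: "finite {j. lam j \<le> u}"
proof -
  obtain J where "lam J > u" using lam_unbounded by (auto simp: bdd_above_def not_le)
  then have "{j. lam j \<le> u} \<subseteq> {..<J}"
    using lam_mono by (auto simp: strict_mono_less[symmetric] not_less[symmetric] strict_mono_less_eq)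
  then show ?thesis using finite_subset by blast
qed

lemma C_nonneg: "C \<ge> 0"
  using remainder_bound[of 0] by simp

lemma abs_R_le: "\<bar>R u\<bar> \<le> C * exp (\<beta> * u)"
  using remainder_bound[of u] by (simp add: R_def A_def)

lemma A_mono: "mono A"
  unfolding mono_def A_def using finite_le a_pos
  by (auto intro!: sum_mono2 simp: less_imp_le)

lemma R_measurable [measurable]: "R \<in> borel_measurable borel"
  unfolding R_def using borel_measurable_mono[OF A_mono] by simp

text \<open>Partial summation for dA - \<rho> e^x dx. The step function A is written as a finite sum
  of indicators, so each jump and the exponential can be integrated by the fundamental theorem of
  calculus.\<close>

lemma has_integral_R_exp:
  assumes uv: "u \<le> v" and s: "s \<noteq> 1"
  shows "((\<lambda>x. s * of_real (R x) * exp (- (s * of_real x))) has_integral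
    (G v s - G u s - of_real (R v) * exp (- (s * of_real v)) + of_real (R u) * exp (- (s * of_real u)))) {u..v}"
proof -
  let ?e = "\<lambda>x::real. exp (- (s * of_real x))"
  let ?E = "\<lambda>x::real. exp ((1 - s) * of_real x)"
  let ?S = "{j. lam j \<le> v}"
  have ftc: "((\<lambda>x. s * ?e x) has_integral (?e p - ?e v)) {p..v}" if "p \<le> v" for p
  proof -
    have "((\<lambda>x. s * ?e x) has_integral (- ?e v - - ?e p)) {p..v}"
      using that by (intro fundamental_theorem_of_calculus)
        (auto intro!: derivative_eq_intros has_vector_derivative_real_field simp: algebra_simps)
    then show ?thesis by simp
  qed
  \<comment> \<open>A jump before u is already present on the whole interval, hence the lower limit
    \<open>max u (lam j)\<close>.\<close>
  have step: "((\<lambda>x. if lam j \<le> x then s * ?e x else 0) has_integral (?e (max u (lam j)) - ?e v)) {u..v}"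
    if "lam j \<le> v" for j
  proof -
    have "((\<lambda>x. if x \<in> {max u (lam j)..v} then s * ?e x else 0) has_integral
        (?e (max u (lam j)) - ?e v)) {u..v}"
      by (subst has_integral_restrict) (use ftc[of "max u (lam j)"] that uv in auto)
    then show ?thesis by (rule has_integral_eq[rotated]) auto
  qed
  have 1: "((\<lambda>x. \<Sum>j\<in>?S. of_real (a j) * (if lam j \<le> x then s * ?e x else 0)) has_integral
      (\<Sum>j\<in>?S. of_real (a j) * (?e (max u (lam j)) - ?e v))) {u..v}"
    by (intro has_integral_sum finite_le has_integral_mult_right step) auto
  have 2: "((\<lambda>x. s * ?E x) has_integral (s / (1 - s) * ?E v - s / (1 - s) * ?E u)) {u..v}"
    using s uv by (intro fundamental_theorem_of_calculus)
      (auto intro!: derivative_eq_intros has_vector_derivative_real_field)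
  have int: "((\<lambda>x. (\<Sum>j\<in>?S. of_real (a j) * (if lam j \<le> x then s * ?e x else 0)) - of_real \<rho> * (s * ?E x))
     has_integral ((\<Sum>j\<in>?S. of_real (a j) * (?e (max u (lam j)) - ?e v))
      - of_real \<rho> * (s / (1 - s) * ?E v - s / (1 - s) * ?E u))) {u..v}"
    by (intro has_integral_diff 1 has_integral_mult_right 2)
  have fun_eq: "(\<Sum>j\<in>?S. of_real (a j) * (if lam j \<le> x then s * ?e x else 0)) - of_real \<rho> * (s * ?E x)
      = s * of_real (R x) * ?e x" if x: "x \<in> {u..v}" for x
  proof -
    have "(\<Sum>j\<in>?S. of_real (a j) * (if lam j \<le> x then s * ?e x else 0))
        = (\<Sum>j | lam j \<le> x. of_real (a j) * (s * ?e x))"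
      using x by (intro sum.mono_neutral_cong_right finite_le) auto
    also have "\<dots> = of_real (A x) * (s * ?e x)"
      by (simp add: A_def sum_distrib_right)
    finally show ?thesis
      by (simp add: R_def algebra_simps exp_diff exp_minus divide_inverse exp_of_real
          flip: of_real_exp)
  qed
  \<comment> \<open>Where \<open>lam j\<close> > u the maximum is \<open>lam j\<close> itself and
    the summand vanishes.\<close>
  have "(\<Sum>j\<in>?S. of_real (a j) * (?e (max u (lam j)) - ?e (lam j)))
      = (\<Sum>j | lam j \<le> u. of_real (a j) * (?e u - ?e (lam j)))"
    using uv by (intro sum.mono_neutral_cong_right finite_le) (auto simp: max_def)
  then have "(\<Sum>j\<in>?S. of_real (a j) * ?e (max u (lam j))) = D v s - D u s + of_real (A u) * ?e u"
    by (simp add: D_def A_def algebra_simps sum_subtractf sum_distrib_left)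
  then have sum_eq: "(\<Sum>j\<in>?S. of_real (a j) * (?e (max u (lam j)) - ?e v))
     = D v s - D u s + of_real (A u) * ?e u - of_real (A v) * ?e v"
    by (simp add: A_def algebra_simps sum_subtractf sum_distrib_left)
  have E: "?E x = of_real (exp x) * ?e x" for x
    by (simp add: algebra_simps exp_diff exp_minus divide_inverse flip: exp_of_real)
  \<comment> \<open>This splits the integrated main term: the -1 supplies the part \<rho> e^x of R
    in the boundary terms, the -1/(s-1) supplies the pole term of G.\<close>
  have q: "s / (1 - s) = - 1 - 1 / (s - 1)" using s by (simp add: field_simps)
  have val: "(\<Sum>j\<in>?S. of_real (a j) * (?e (max u (lam j)) - ?e v))
      - of_real \<rho> * (s / (1 - s) * ?E v - s / (1 - s) * ?E u)
    = G v s - G u s - of_real (R v) * ?e v + of_real (R u) * ?e u"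
    unfolding sum_eq q G_def R_def E by (simp add: algebra_simps)
  show ?thesis
    by (rule has_integral_eq[OF fun_eq int[unfolded val]])
qed

lemma norm_R_exp_le: "cmod (of_real (R u) * exp (- (s * of_real u))) \<le> C * exp ((\<beta> - Re s) * u)"
proof -
  have "cmod (of_real (R u) * exp (- (s * of_real u))) = \<bar>R u\<bar> * exp (- (Re s * u))"
    by (simp add: norm_mult)
  also have "\<dots> \<le> C * exp (\<beta> * u) * exp (- (Re s * u))"
    by (intro mult_right_mono abs_R_le) auto
  finally show ?thesis by (simp add: algebra_simps flip: exp_add)
qed

text \<open>The 2 accounts for the boundary values of R, the quotient for its integral. The bound
  does not involve v, so it serves both as a Cauchy criterion and, in the limit, as an error
  estimate.\<close>

lemma norm_G_diff_le:
  assumes uv: "u \<le> v" and s: "s \<noteq> 1" "Re s > \<beta>"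
  shows "cmod (G v s - G u s) \<le> C * (2 + cmod s / (Re s - \<beta>)) * exp ((\<beta> - Re s) * u)"
proof -
  let ?g = "\<lambda>x. s * of_real (R x) * exp (- (s * of_real x))"
  let ?b = "\<lambda>x. cmod s * C * exp ((\<beta> - Re s) * x)"
  let ?k = "cmod s * C / (\<beta> - Re s)"
  have b: "(?b has_integral (?k * exp ((\<beta> - Re s) * v) - ?k * exp ((\<beta> - Re s) * u))) {u..v}"
    using uv s by (intro fundamental_theorem_of_calculus)
      (auto intro!: derivative_eq_intros simp: has_real_derivative_iff_has_vector_derivative[symmetric])
  have "cmod (integral {u..v} ?g) \<le> integral {u..v} ?b"
  proof (rule integral_norm_bound_integral)
    show "?g integrable_on {u..v}" using has_integral_R_exp[OF uv s(1)] by blast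
    show "?b integrable_on {u..v}" using b by blast
    fix x
    show "norm (?g x) \<le> ?b x"
      using mult_left_mono[OF norm_R_exp_le[of x s], of "cmod s"] by (simp add: norm_mult mult.assoc)
  qed
  also have "\<dots> = ?k * exp ((\<beta> - Re s) * v) - ?k * exp ((\<beta> - Re s) * u)"
    using b by (rule integral_unique)
  also have "\<dots> \<le> - ?k * exp ((\<beta> - Re s) * u)"
    using s C_nonneg by (simp add: mult_nonneg_nonpos2 divide_nonneg_neg)
  finally have 1: "cmod (integral {u..v} ?g) \<le> C * (cmod s / (Re s - \<beta>)) * exp ((\<beta> - Re s) * u)"
    using s by (simp add: field_simps)
  have "exp ((\<beta> - Re s) * v) \<le> exp ((\<beta> - Re s) * u)"
    using uv s by (simp add: mult_left_mono_neg)
  then have 2: "C * exp ((\<beta> - Re s) * v) \<le> C * exp ((\<beta> - Re s) * u)"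
    using C_nonneg by (rule mult_left_mono)
  have "G v s - G u s = integral {u..v} ?g + of_real (R v) * exp (- (s * of_real v))
      - of_real (R u) * exp (- (s * of_real u))"
    using has_integral_R_exp[OF uv s(1)] by (simp add: integral_unique)
  then have "cmod (G v s - G u s) \<le> cmod (integral {u..v} ?g) + C * exp ((\<beta> - Re s) * v)
      + C * exp ((\<beta> - Re s) * u)"
    using norm_R_exp_le[of v s] norm_R_exp_le[of u s]
    by (smt (verit) norm_triangle_ineq norm_triangle_ineq4)
  then show ?thesis using 1 2 by (simp add: algebra_simps)
qed

lemma G_convergent:
  assumes s: "s \<noteq> 1" "Re s > \<beta>"
  shows "(\<lambda>k. G (real k) s) \<longlonglongrightarrow> F s"
proof -
  define K where "K = C * (2 + cmod s / (Re s - \<beta>))"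
  have "Cauchy (\<lambda>k. G (real k) s)"
  proof (rule CauchyI)
    fix e :: real assume e: "e > 0"
    have "(\<lambda>k. K * exp ((\<beta> - Re s) * real k)) \<longlonglongrightarrow> 0"
      using s by (intro filterlim_compose[OF tendsto_exp_neg_mult filterlim_real_sequentially]) auto
    then have "eventually (\<lambda>k. K * exp ((\<beta> - Re s) * real k) < e / 2) sequentially"
      using e by (auto dest!: order_tendstoD(2)[where a = "e/2"])
    then obtain N where N: "K * exp ((\<beta> - Re s) * real N) < e / 2"
      by (auto simp: eventually_sequentially)
    have d: "cmod (G (real m) s - G (real N) s) < e / 2" if "m \<ge> N" for m
      using norm_G_diff_le[of "real N" "real m" s] s that N unfolding K_def by linarith
    show "\<exists>M. \<forall>m\<ge>M. \<forall>n\<ge>M. norm (G (real m) s - G (real n) s) < e"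
      by (intro exI[of _ N] allI impI) (use d norm_triangle_half_l in \<open>metis dist_norm dist_commute\<close>)
  qed
  then show ?thesis unfolding F_def by (simp add: Cauchy_convergent_iff convergent_LIMSEQ_iff)
qed

text \<open>Although F is a limit along integers, the estimate holds at every real u; cuts at
  arbitrary points and the limit along \<open>lam m\<close> rely on this.\<close>

lemma norm_F_minus_G_le:
  assumes s: "s \<noteq> 1" "Re s > \<beta>"
  shows "cmod (F s - G u s) \<le> C * (2 + cmod s / (Re s - \<beta>)) * exp ((\<beta> - Re s) * u)"
proof (rule tendsto_upperbound)
  show "((\<lambda>k. cmod (G (real k) s - G u s)) \<longlongrightarrow> cmod (F s - G u s)) sequentially"
    by (intro tendsto_intros G_convergent s)
  show "\<forall>\<^sub>F k in sequentially. cmod (G (real k) s - G u s) \<le> C * (2 + cmod s / (Re s - \<beta>)) * exp ((\<beta> - Re s) * u)"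
    using eventually_ge_at_top[of "nat \<lceil>u\<rceil>"]
    by eventually_elim (rule norm_G_diff_le, use s in \<open>auto simp: nat_le_iff ceiling_le_iff\<close>)
qed simp

lemma tendsto_G:
  assumes s: "s \<noteq> 1" "Re s > \<beta>"
  shows "((\<lambda>u. G u s) \<longlongrightarrow> F s) at_top"
proof (rule LIM_zero_cancel, rule Lim_null_comparison)
  show "((\<lambda>u. C * (2 + cmod s / (Re s - \<beta>)) * exp ((\<beta> - Re s) * u)) \<longlongrightarrow> 0) at_top"
    using s by (intro tendsto_exp_neg_mult) auto
  show "\<forall>\<^sub>F u in at_top. cmod (G u s - F s) \<le> C * (2 + cmod s / (Re s - \<beta>)) * exp ((\<beta> - Re s) * u)"
    using norm_F_minus_G_le[OF s] by (simp add: norm_minus_commute)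
qed

text \<open>For Re s > 1 the pole term in G tends to 0, so D alone converges to F; at u =
  \<open>lam m\<close> the value of D is a partial sum of the series.\<close>

lemma F_sums:
  assumes s: "Re s > 1"
  shows "(\<lambda>j. of_real (a j) * exp (- (s * of_real (lam j)))) sums F s"
proof -
  have lam_top: "filterlim lam at_top sequentially"
    unfolding filterlim_at_top
  proof
    fix Z
    obtain J where "lam J > Z" using lam_unbounded by (auto simp: bdd_above_def not_le)
    then show "\<forall>\<^sub>F n in sequentially. Z \<le> lam n"
      unfolding eventually_sequentially using lam_mono
      by (metis less_imp_le order_trans strict_mono_less_eq)
  qed
  have "((\<lambda>u. of_real \<rho> * exp ((1 - s) * of_real u) / (s - 1)) \<longlongrightarrow> 0) at_top"
  proof (rule Lim_null_comparison)
    show "((\<lambda>u. \<rho> / cmod (s - 1) * exp ((1 - Re s) * u)) \<longlongrightarrow> 0) at_top"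
      using s by (intro tendsto_exp_neg_mult) auto
    show "\<forall>\<^sub>F u in at_top. norm (of_real \<rho> * exp ((1 - s) * of_real u) / (s - 1)) \<le> \<rho> / cmod (s - 1) * exp ((1 - Re s) * u)"
      using rho_pos by (simp add: norm_mult norm_divide)
  qed
  moreover have "((\<lambda>u. G u s) \<longlongrightarrow> F s) at_top"
    using s beta by (intro tendsto_G) auto
  ultimately have "((\<lambda>u. G u s - of_real \<rho> * exp ((1 - s) * of_real u) / (s - 1)) \<longlongrightarrow> F s - 0) at_top"
    by (intro tendsto_diff)
  then have "((\<lambda>u. D u s) \<longlongrightarrow> F s) at_top" by (simp add: G_def)
  then have "(\<lambda>m. D (lam m) s) \<longlonglongrightarrow> F s" using lam_top by (rule filterlim_compose)
  moreover have "D (lam m) s = (\<Sum>j\<le>m. of_real (a j) * exp (- (s * of_real (lam j))))" for m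
    using lam_mono by (simp add: D_def strict_mono_less_eq atMost_def)
  ultimately show ?thesis by (simp add: sums_def_le)
qed

lemma F_holomorphic: "F holomorphic_on {s. Re s > \<beta>} - {1}"
proof -
  let ?S = "{s. Re s > \<beta>} - {1::complex}"
  have op: "open ?S" by (intro open_delete) (simp add: open_halfspace_Re_gt)
  show ?thesis
  proof (rule holomorphic_uniform_sequence[where f = "\<lambda>k. G (real k)"])
    show "open ?S" by (rule op)
    show "G (real k) holomorphic_on ?S" for k
      unfolding G_def D_def by (intro holomorphic_intros) auto
    fix x assume x: "x \<in> ?S"
    then obtain d where d: "d > 0" "cball x d \<subseteq> ?S" using op open_contains_cball by blast
    have comp: "compact (cball x d)" by simp
    have ne: "cball x d \<noteq> {}" using d by simp
    \<comment> \<open>The leftmost point of the disc gives a gap r between the disc and the line Re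
      z = \<beta>, hence a rate of convergence e^(-r k) valid on the whole disc.\<close>
    obtain y where y: "y \<in> cball x d" "\<And>z. z \<in> cball x d \<Longrightarrow> Re y \<le> Re z"
      using continuous_attains_inf[OF comp ne continuous_on_Re[OF continuous_on_id]] by blast
    define r where "r = Re y - \<beta>"
    have r: "r > 0" "\<And>z. z \<in> cball x d \<Longrightarrow> r \<le> Re z - \<beta>" using y d by (auto simp: r_def)
    define K where "K = C * (2 + (cmod x + d) / r)"
    have "uniform_limit (cball x d) (\<lambda>k. G (real k)) F sequentially"
    proof (rule uniform_limitI)
      fix e :: real assume e: "e > 0"
      have "(\<lambda>k. K * exp (- r * real k)) \<longlonglongrightarrow> 0"
        using r by (intro filterlim_compose[OF tendsto_exp_neg_mult filterlim_real_sequentially]) auto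
      then have "\<forall>\<^sub>F k in sequentially. K * exp (- r * real k) < e"
        using e by (auto dest!: order_tendstoD(2)[where a = e])
      then show "\<forall>\<^sub>F k in sequentially. \<forall>z\<in>cball x d. dist (G (real k) z) (F z) < e"
      proof eventually_elim
        case (elim k)
        show ?case
        proof
          fix z assume z: "z \<in> cball x d"
          have "cmod z \<le> cmod x + d"
            using z norm_triangle_ineq2[of z x] by (simp add: dist_norm norm_minus_commute)
          then have "cmod z / (Re z - \<beta>) \<le> (cmod x + d) / r"
            using r z d(1) by (intro frac_le) auto
          moreover have "0 \<le> cmod z / (Re z - \<beta>)" using r(2)[OF z] r(1) by simp
          moreover have "(\<beta> - Re z) * real k \<le> - r * real k"
            using r(2)[OF z] by (intro mult_right_mono) auto
          ultimately have "C * (2 + cmod z / (Re z - \<beta>)) * exp ((\<beta> - Re z) * real k) \<le> K * exp (- r * real k)"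
            unfolding K_def using C_nonneg r d
            by (intro mult_mono mult_nonneg_nonneg add_nonneg_nonneg) auto
          moreover have "z \<noteq> 1" "Re z > \<beta>" using z d by auto
          ultimately show "dist (G (real k) z) (F z) < e"
            using norm_F_minus_G_le[of z "real k"] elim by (simp add: dist_norm norm_minus_commute)
        qed
      qed
    qed
    then show "\<exists>d>0. cball x d \<subseteq> ?S \<and> uniform_limit (cball x d) (\<lambda>k. G (real k)) F sequentially"
      using d by blast
  qed
qed

subsection \<open>Mean square of the remainder\<close>

text \<open>Cells are open on the left and closed on the right, in accordance with the weak
  inequality in A and D, so that consecutive cells tile an interval without overlap.\<close>

definition cell_mass :: "real \<Rightarrow> real \<Rightarrow> real \<Rightarrow> real" where
  "cell_mass \<sigma> h u = (\<Sum>j | u < lam j \<and> lam j \<le> u + h. a j * exp (- (\<sigma> * lam j)))"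

lemma finite_cell: "finite {j. u < lam j \<and> lam j \<le> v}"
  by (rule finite_subset[OF _ finite_le[of v]]) auto

lemma sum_cells:
  fixes f :: "nat \<Rightarrow> 'b :: comm_monoid_add"
  assumes h: "h > 0"
  shows "(\<Sum>j | u < lam j \<and> lam j \<le> u + real K * h. f j)
    = (\<Sum>k<K. \<Sum>j | u + real k * h < lam j \<and> lam j \<le> u + real k * h + h. f j)"
proof (induction K)
  case (Suc K)
  have "u < x" if "u + real K * h < x" for x
    using h that by (smt (verit) mult_nonneg_nonneg of_nat_0_le_iff)
  then have "{j. u < lam j \<and> lam j \<le> u + real (Suc K) * h} = {j. u < lam j \<and> lam j \<le> u + real K * h}
      \<union> {j. u + real K * h < lam j \<and> lam j \<le> u + real K * h + h}"
    using h by (auto simp: algebra_simps)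
  then show ?case using Suc
    by (simp, subst sum.union_disjoint) (auto intro: finite_cell)
next
  case 0
  have "{j. u < lam j \<and> lam j \<le> u + real 0 * h} = {}" by auto
  then show ?case by (simp only: sum.empty lessThan_0)
qed

lemma D_diff:
  assumes "u \<le> v"
  shows "D v s - D u s = (\<Sum>j | u < lam j \<and> lam j \<le> v. of_real (a j) * exp (- (s * of_real (lam j))))"
proof -
  have "{j. lam j \<le> v} = {j. lam j \<le> u} \<union> {j. u < lam j \<and> lam j \<le> v}"
    using assms by auto
  then show ?thesis
    by (simp add: D_def, subst sum.union_disjoint) (auto intro: finite_cell finite_le)
qed

text \<open>In cell k each frequency is u + k h plus an offset in (0, h]. The constant part of the
  Abel formula gives an orthogonal sum whose coefficients are the cell masses; the integral part
  gives t times a periodized integral. Both have mean square controlled by the squared masses,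
  whatever the positions within the cells.\<close>

lemma D_diff_mean_square:
  assumes h: "h > 0"
  obtains Y where "continuous_on UNIV Y"
    and "\<And>t. t \<in> {0..2 * pi / h} \<Longrightarrow>
      (cmod (D (u + real K * h) (Complex \<sigma> t) - D u (Complex \<sigma> t)))\<^sup>2 \<le> Y t"
    and "integral {0..2 * pi / h} Y
      \<le> (2 + 8 * pi\<^sup>2) * (2 * pi / h) * (\<Sum>k<K. (cell_mass \<sigma> h (u + real k * h))\<^sup>2)"
proof -
  define T where "T = 2 * pi / h"
  have T: "T > 0" "T * h = 2 * pi" using h by (auto simp: T_def)
  define uk where "uk k = u + real k * h" for k
  define cell where "cell k = {j. uk k < lam j \<and> lam j \<le> uk k + h}" for k
  define B where "B k = cell_mass \<sigma> h (uk k)" for k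
  define b where "b j = a j * exp (- (\<sigma> * lam j))" for j
  \<comment> \<open>The mass of the points of cell k whose offset is at least v, hence between 0 and
    the full mass \<open>B k\<close>.\<close>
  define c where "c = (\<lambda>k v. \<Sum>j\<in>cell k. b j * (if v \<le> lam j - uk k then 1 else 0))"
  have b: "b j \<ge> 0" for j using a_pos[of j] by (simp add: b_def)
  have B: "B k = (\<Sum>j\<in>cell k. b j)" for k
    by (simp add: B_def cell_mass_def cell_def b_def)
  have fin [simp]: "finite (cell k)" for k by (simp add: cell_def finite_cell)
  have c_abs: "\<bar>c k v\<bar> \<le> B k" for k v
  proof -
    have "\<bar>c k v\<bar> = c k v" unfolding c_def using b by (intro abs_of_nonneg sum_nonneg) auto
    also have "\<dots> \<le> B k" unfolding c_def B using b by (intro sum_mono) auto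
    finally show ?thesis .
  qed
  have c_meas: "c k \<in> borel_measurable borel" for k
    unfolding c_def by measurable
  define X where "X t = integral {0..h} (\<lambda>v. cis (- (t * v)) * (\<Sum>k<K. of_real (c k v) * cis (- (t * (k * h)))))" for t
  obtain Y where Y: "continuous_on UNIV Y" "\<And>t. (cmod (X t))\<^sup>2 \<le> Y t"
    "integral {0..T} Y \<le> 2 * pi * h * (\<Sum>k<K. (B k)\<^sup>2)"
    unfolding X_def T_def
    by (rule mean_square_periodized[of h K c B, OF h c_meas c_abs])
      (rule that[unfolded X_def T_def] | assumption)+
  define Z where "Z t = (\<Sum>k<K. \<Sum>l<K. B k * B l * cos ((real k * h - real l * h) * t))" for t
  have Z: "(Z has_integral T * (\<Sum>k<K. (B k)\<^sup>2)) {0..T}"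
    unfolding Z_def T_def power2_eq_square by (rule has_integral_norm_exp_sum_squared[OF h])
  have decomp: "D (u + real K * h) (Complex \<sigma> t) - D u (Complex \<sigma> t)
     = cis (- (t * u)) * ((\<Sum>k<K. of_real (B k) * cis (- (t * (k * h)))) - \<i> * of_real t * X t)" for t
  proof -
    obtain W where W: "\<And>\<phi>. 0 \<le> \<phi> \<Longrightarrow> \<phi> \<le> h \<Longrightarrow>
        ((\<lambda>v. cis (- (t * v)) * of_real (if v \<le> \<phi> then 1 else 0)) has_integral W \<phi>) {0..h}"
      "\<And>\<phi>. 0 \<le> \<phi> \<Longrightarrow> \<phi> \<le> h \<Longrightarrow> cis (- (t * \<phi>)) = 1 - \<i> * of_real t * W \<phi>"
      by (rule cis_interval_integral[of h t]) (rule that | assumption)+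
    have "((\<lambda>v. \<Sum>k<K. \<Sum>j\<in>cell k. cis (- (t * (k * h))) * (of_real (b j) *
         (cis (- (t * v)) * of_real (if v \<le> lam j - uk k then 1 else 0))))
       has_integral (\<Sum>k<K. \<Sum>j\<in>cell k. cis (- (t * (k * h))) * (of_real (b j) * W (lam j - uk k)))) {0..h}"
      by (intro has_integral_sum has_integral_mult_right W fin finite_lessThan) (auto simp: cell_def)
    also have "(\<lambda>v. \<Sum>k<K. \<Sum>j\<in>cell k. cis (- (t * (k * h))) * (of_real (b j) *
         (cis (- (t * v)) * of_real (if v \<le> lam j - uk k then 1 else 0))))
       = (\<lambda>v. cis (- (t * v)) * (\<Sum>k<K. of_real (c k v) * cis (- (t * (k * h)))))"
      unfolding c_def of_real_sum of_real_mult sum_distrib_left sum_distrib_right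
      by (intro ext sum.cong refl) (simp only: mult_ac)
    finally have X: "X t = (\<Sum>k<K. \<Sum>j\<in>cell k. cis (- (t * (k * h))) * (of_real (b j) * W (lam j - uk k)))"
      unfolding X_def by (rule integral_unique)
    have "D (u + real K * h) (Complex \<sigma> t) - D u (Complex \<sigma> t)
      = (\<Sum>k<K. \<Sum>j\<in>cell k. of_real (a j) * exp (- (Complex \<sigma> t * of_real (lam j))))"
      using h by (subst D_diff) (auto simp: sum_cells cell_def uk_def)
    also have "\<dots> = (\<Sum>k<K. \<Sum>j\<in>cell k. cis (- (t * u)) * cis (- (t * (k * h))) * of_real (b j) *
        (1 - \<i> * of_real t * W (lam j - uk k)))"
    proof (intro sum.cong refl)
      fix k j assume j: "j \<in> cell k"
      have "cis (- (t * lam j)) = cis (- (t * u)) * cis (- (t * (k * h))) * cis (- (t * (lam j - uk k)))"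
        by (simp add: cis_mult uk_def algebra_simps)
      also have "cis (- (t * (lam j - uk k))) = 1 - \<i> * of_real t * W (lam j - uk k)"
        using j by (intro W(2)) (auto simp: cell_def)
      finally show "of_real (a j) * exp (- (Complex \<sigma> t * of_real (lam j))) =
         cis (- (t * u)) * cis (- (t * (k * h))) * of_real (b j) * (1 - \<i> * of_real t * W (lam j - uk k))"
        by (simp add: exp_neg_Complex b_def mult_ac)
    qed
    also have "\<dots> = cis (- (t * u)) * ((\<Sum>k<K. of_real (B k) * cis (- (t * (k * h)))) - \<i> * of_real t * X t)"
      unfolding X B of_real_sum
      by (simp add: sum_distrib_left sum_distrib_right sum_subtractf[symmetric] algebra_simps)
    finally show ?thesis .
  qed
  show thesis
  proof
    show "continuous_on UNIV (\<lambda>t. 2 * Z t + 2 * T\<^sup>2 * Y t)"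
      unfolding Z_def by (intro continuous_intros Y(1))
  next
    fix t assume "t \<in> {0..2 * pi / h}"
    then have t: "0 \<le> t" "t \<le> T" by (auto simp: T_def)
    have "(cmod (D (u + real K * h) (Complex \<sigma> t) - D u (Complex \<sigma> t)))\<^sup>2
       = (cmod ((\<Sum>k<K. of_real (B k) * cis (- (t * (k * h)))) - \<i> * of_real t * X t))\<^sup>2"
      by (simp add: decomp norm_mult)
    also have "\<dots> \<le> (cmod (\<Sum>k<K. of_real (B k) * cis (- (t * (k * h)))) + t * cmod (X t))\<^sup>2"
      using norm_triangle_ineq4[of "\<Sum>k<K. of_real (B k) * cis (- (t * (k * h)))" "\<i> * of_real t * X t"] t
      by (intro power_mono) (auto simp: norm_mult)
    also have "\<dots> \<le> 2 * (cmod (\<Sum>k<K. of_real (B k) * cis (- (t * (k * h)))))\<^sup>2 + 2 * (t * cmod (X t))\<^sup>2"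
      by (rule power2_sum_le_double)
    also have "\<dots> \<le> 2 * Z t + 2 * T\<^sup>2 * Y t"
      unfolding norm_exp_sum_squared Z_def power_mult_distrib
      using mult_mono[OF power_mono[OF t(2,1), of 2] Y(2)[of t]] by simp
    finally show "(cmod (D (u + real K * h) (Complex \<sigma> t) - D u (Complex \<sigma> t)))\<^sup>2 \<le> 2 * Z t + 2 * T\<^sup>2 * Y t" .
  next
    have Yi: "(Y has_integral integral {0..T} Y) {0..T}"
      using Y(1) by (intro integrable_integral integrable_continuous_real continuous_on_subset[OF Y(1)]) auto
    have "((\<lambda>t. 2 * Z t + 2 * T\<^sup>2 * Y t) has_integral
        2 * (T * (\<Sum>k<K. (B k)\<^sup>2)) + 2 * T\<^sup>2 * integral {0..T} Y) {0..T}"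
      by (intro has_integral_add has_integral_mult_right Z Yi)
    then have "integral {0..T} (\<lambda>t. 2 * Z t + 2 * T\<^sup>2 * Y t)
        \<le> 2 * (T * (\<Sum>k<K. (B k)\<^sup>2)) + 2 * T\<^sup>2 * (2 * pi * h * (\<Sum>k<K. (B k)\<^sup>2))"
      using mult_left_mono[OF Y(3), of "2 * T\<^sup>2"] by (subst integral_unique) auto
    \<comment> \<open>One of the two factors T is consumed by h through T h = 2 pi; this is the
      origin of 8 pi^2, while the 2 comes from the orthogonal sum.\<close>
    also have "2 * T\<^sup>2 * (2 * pi * h * (\<Sum>k<K. (B k)\<^sup>2)) = 2 * T * (2 * pi * (T * h)) * (\<Sum>k<K. (B k)\<^sup>2)"
      by (simp add: power2_eq_square)
    also have "2 * (T * (\<Sum>k<K. (B k)\<^sup>2)) + 2 * T * (2 * pi * (T * h)) * (\<Sum>k<K. (B k)\<^sup>2)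
        = (2 + 8 * pi\<^sup>2) * T * (\<Sum>k<K. (B k)\<^sup>2)"
      unfolding T(2) by (simp add: algebra_simps power2_eq_square)
    finally show "integral {0..2 * pi / h} (\<lambda>t. 2 * Z t + 2 * T\<^sup>2 * Y t)
       \<le> (2 + 8 * pi\<^sup>2) * (2 * pi / h) * (\<Sum>k<K. (cell_mass \<sigma> h (u + real k * h))\<^sup>2)"
      by (simp add: T_def B_def uk_def)
  qed
qed

text \<open>The integrand already varies continuously, so writing x = u + k h + v gives the
  periodized form without Abel summation. The majorants decay geometrically in k, which makes the
  bound independent of K: the upper limit may lie arbitrarily far out. The factor s is kept outside,
  since it is not periodic in t.\<close>

lemma R_exp_mean_square:
  assumes h: "h > 0" and \<sigma>: "\<sigma> > \<beta>"
  obtains Y where "continuous_on UNIV Y"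
    and "\<And>t. (cmod (integral {u..u + real K * h} (\<lambda>x. of_real (R x) * exp (- (Complex \<sigma> t * of_real x)))))\<^sup>2 \<le> Y t"
    and "integral {0..2 * pi / h} Y \<le> 2 * pi * C\<^sup>2 * exp (2 * (\<beta> - \<sigma>) * u) * (h + 1 / (2 * (\<sigma> - \<beta>)))"
proof -
  define d where "d k = C * exp ((\<beta> - \<sigma>) * (u + real k * h))" for k
  define c where "c = (\<lambda>k v. R (u + real k * h + v) * exp (- (\<sigma> * (u + real k * h + v))))"
  have R_abs: "\<bar>R x\<bar> * exp (- (\<sigma> * x)) \<le> C * exp ((\<beta> - \<sigma>) * x)" for x
  proof -
    have "\<bar>R x\<bar> * exp (- (\<sigma> * x)) \<le> C * exp (\<beta> * x) * exp (- (\<sigma> * x))"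
      by (intro mult_right_mono abs_R_le) auto
    then show ?thesis by (simp add: algebra_simps flip: exp_add)
  qed
  have c_abs: "\<bar>c k v\<bar> \<le> d k" if "v \<in> {0..h}" for k v
  proof -
    have "\<bar>c k v\<bar> \<le> C * exp ((\<beta> - \<sigma>) * (u + real k * h + v))"
      using R_abs[of "u + real k * h + v"] by (simp add: c_def abs_mult)
    also have "\<dots> \<le> d k"
      unfolding d_def using C_nonneg that \<sigma> by (intro mult_left_mono) (auto intro!: mult_left_mono_neg)
    finally show ?thesis .
  qed
  have c_meas: "c k \<in> borel_measurable borel" for k
    unfolding c_def by measurable
  obtain Y where Y: "continuous_on UNIV Y"
    "\<And>t. (cmod (integral {0..h} (\<lambda>v. cis (- (t * v)) * (\<Sum>k<K. of_real (c k v) * cis (- (t * (k * h)))))))\<^sup>2 \<le> Y t"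
    "integral {0..2 * pi / h} Y \<le> 2 * pi * h * (\<Sum>k<K. (d k)\<^sup>2)"
    by (rule mean_square_periodized[of h K c d, OF h c_meas c_abs]) (rule that | assumption)+
  show thesis
  proof
    show "continuous_on UNIV Y" by (rule Y(1))
    fix t
    let ?g = "\<lambda>x. of_real (R x) * exp (- (Complex \<sigma> t * of_real x))"
    have gc: "?g (u + real k * h + v) = cis (- (t * u)) * (cis (- (t * v)) * (of_real (c k v) * cis (- (t * (k * h)))))" for k v
      unfolding exp_neg_Complex c_def by (simp add: cis_mult algebra_simps)
    have int: "?g integrable_on {x..y}" for x y
    proof (rule integrable_on_bounded_measurable)
      show "?g \<in> borel_measurable borel"
        by (intro borel_measurable_times borel_measurable_of_real R_measurable)
          (auto intro!: borel_measurable_continuous_onI continuous_intros)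
      fix z assume "z \<in> {x..y}"
      then have "C * exp ((\<beta> - \<sigma>) * z) \<le> C * exp ((\<beta> - \<sigma>) * x)"
        using C_nonneg \<sigma> by (intro mult_left_mono) (auto intro!: mult_left_mono_neg)
      then show "norm (?g z) \<le> C * exp ((\<beta> - \<sigma>) * x)"
        using R_abs[of z] by (simp add: exp_neg_Complex norm_mult)
    qed
    have shift: "(\<lambda>v. ?g (u + real k * h + v)) integrable_on {0..h}" for k
      using integrable_on_shift_Icc_real[of ?g "u + real k * h" 0 h] int by (simp only: comp_def)
    have "integral {u..u + real K * h} ?g = integral {0..h} (\<lambda>v. \<Sum>k<K. ?g (u + real k * h + v))"
      using shift by (simp only: integral_split_cells[OF h int] integral_sum finite_lessThan)
    also have "\<dots> = cis (- (t * u)) * integral {0..h} (\<lambda>v. cis (- (t * v)) * (\<Sum>k<K. of_real (c k v) * cis (- (t * (k * h)))))"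
      unfolding gc sum_distrib_left[symmetric] by (rule integral_mult_right)
    finally show "(cmod (integral {u..u + real K * h} ?g))\<^sup>2 \<le> Y t"
      using Y(2)[of t] by (simp add: norm_mult)
  next
    have "(\<Sum>k<K. (d k)\<^sup>2) = C\<^sup>2 * exp (2 * (\<beta> - \<sigma>) * u) * (\<Sum>k<K. exp (- (2 * (\<sigma> - \<beta>) * h * real k)))"
      unfolding d_def power_mult_distrib sum_distrib_left mult.assoc
      by (intro sum.cong refl) (simp add: power2_eq_square algebra_simps flip: exp_add)
    also have "\<dots> \<le> C\<^sup>2 * exp (2 * (\<beta> - \<sigma>) * u) * (1 + 1 / (2 * (\<sigma> - \<beta>) * h))"
      using h \<sigma> by (intro mult_left_mono sum_exp_neg_le) auto
    finally have "2 * pi * h * (\<Sum>k<K. (d k)\<^sup>2) \<le> 2 * pi * h * (C\<^sup>2 * exp (2 * (\<beta> - \<sigma>) * u) * (1 + 1 / (2 * (\<sigma> - \<beta>) * h)))"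
      using h by (intro mult_left_mono) auto
    also have "\<dots> = 2 * pi * C\<^sup>2 * exp (2 * (\<beta> - \<sigma>) * u) * (h * (1 + 1 / (2 * (\<sigma> - \<beta>) * h)))"
      by simp
    also have "h * (1 + 1 / (2 * (\<sigma> - \<beta>) * h)) = h + 1 / (2 * (\<sigma> - \<beta>))"
      using h \<sigma> by (simp add: field_simps)
    finally show "integral {0..2 * pi / h} Y \<le> 2 * pi * C\<^sup>2 * exp (2 * (\<beta> - \<sigma>) * u) * (h + 1 / (2 * (\<sigma> - \<beta>)))"
      using Y(3) by linarith
  qed
qed

text \<open>The main term uses e^h - 1 \<le> 2 h. The remainders at the two ends cost 3 C and C
  times e^(\<beta> u), because e^(\<beta> h) \<le> e \<le> 3. The constants are merged into one,
  which multiplies both terms.\<close>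

lemma A_increment_le:
  assumes h: "0 \<le> h" "h \<le> 1"
  shows "A (u + h) - A u \<le> (2 * \<rho> + 4 * C) * (h * exp u + exp (\<beta> * u))"
proof -
  have "exp h \<le> 1 + h + h\<^sup>2" using h by (rule exp_bound)
  also have "h\<^sup>2 \<le> h" using h by (simp add: power2_eq_square mult_left_le)
  finally have "exp h - 1 \<le> 2 * h" by simp
  then have "\<rho> * exp u * (exp h - 1) \<le> \<rho> * exp u * (2 * h)"
    using rho_pos by (intro mult_left_mono) auto
  then have 1: "\<rho> * exp (u + h) - \<rho> * exp u \<le> 2 * \<rho> * (h * exp u)"
    by (simp add: exp_add algebra_simps)
  have "exp (\<beta> * h) \<le> exp 1" using h beta by (simp add: mult_le_one)
  also have "\<dots> \<le> (3::real)" by (rule exp_le)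
  finally have "exp (\<beta> * (u + h)) \<le> 3 * exp (\<beta> * u)" by (simp add: distrib_left exp_add)
  then have "C * exp (\<beta> * (u + h)) \<le> C * (3 * exp (\<beta> * u))" using C_nonneg by (rule mult_left_mono)
  then have 2: "R (u + h) - R u \<le> 4 * C * exp (\<beta> * u)"
    using abs_R_le[of "u + h"] abs_R_le[of u] by simp
  have "A (u + h) - A u \<le> 2 * \<rho> * (h * exp u) + 4 * C * exp (\<beta> * u)"
    using 1 2 by (simp add: R_def)
  also have "\<dots> \<le> (2 * \<rho> + 4 * C) * (h * exp u) + (2 * \<rho> + 4 * C) * exp (\<beta> * u)"
    using C_nonneg rho_pos h by (intro add_mono mult_right_mono) auto
  finally show ?thesis by (simp add: distrib_left)
qed

lemma cell_mass_nonneg: "cell_mass \<sigma> h u \<ge> 0"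
  unfolding cell_mass_def using a_pos by (intro sum_nonneg mult_nonneg_nonneg) (auto simp: less_imp_le)

lemma cell_mass_le:
  assumes h: "0 \<le> h" "h \<le> 1" and \<sigma>: "\<sigma> \<ge> 0"
  shows "cell_mass \<sigma> h u \<le> (2 * \<rho> + 4 * C) * (h * exp u + exp (\<beta> * u)) * exp (- (\<sigma> * u))"
proof -
  have un: "{j. lam j \<le> u + h} = {j. lam j \<le> u} \<union> {j. u < lam j \<and> lam j \<le> u + h}"
    using h by auto
  have "A (u + h) = A u + (\<Sum>j | u < lam j \<and> lam j \<le> u + h. a j)"
    unfolding A_def un by (subst sum.union_disjoint) (auto intro: finite_le finite_cell)
  moreover have "cell_mass \<sigma> h u \<le> (\<Sum>j | u < lam j \<and> lam j \<le> u + h. a j * exp (- (\<sigma> * u)))"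
    unfolding cell_mass_def using a_pos \<sigma>
    by (intro sum_mono mult_left_mono) (auto simp: less_imp_le intro!: mult_left_mono)
  ultimately have "cell_mass \<sigma> h u \<le> (A (u + h) - A u) * exp (- (\<sigma> * u))"
    by (simp add: sum_distrib_right)
  also have "\<dots> \<le> (2 * \<rho> + 4 * C) * (h * exp u + exp (\<beta> * u)) * exp (- (\<sigma> * u))"
    by (intro mult_right_mono A_increment_le h) auto
  finally show ?thesis .
qed

text \<open>L bounds the main term of a cell mass relative to its error term. One factor of the
  square is replaced by its size e^((\<beta>-\<sigma>)x); the other is kept as a sum. Moving the
  weight from the cell's left end x to \<open>lam j\<close> costs e^(\<sigma>-\<beta>), since cells
  have length at most 1. The result is linear in the coefficients, and so for \<sigma> >
  (1+\<beta>)/2 a piece of a convergent series.\<close>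

lemma cell_mass_squares_le:
  assumes h: "0 < h" "h \<le> 1" and \<sigma>: "\<sigma> > \<beta>"
    and L: "\<And>k. k < K \<Longrightarrow> h * exp ((1 - \<beta>) * (u + real k * h)) \<le> L"
  shows "(\<Sum>k<K. (cell_mass \<sigma> h (u + real k * h))\<^sup>2)
    \<le> (2 * \<rho> + 4 * C) * (1 + L) * exp (\<sigma> - \<beta>) * (\<Sum>j | u < lam j \<and> lam j \<le> u + real K * h. a j * exp ((\<beta> - 2 * \<sigma>) * lam j))"
proof -
  define M where "M = 2 * \<rho> + 4 * C"
  have M: "M \<ge> 0" using rho_pos C_nonneg by (simp add: M_def)
  define S where "S x = (\<Sum>j | x < lam j \<and> lam j \<le> x + h. a j * exp ((\<beta> - 2 * \<sigma>) * lam j))" for x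
  have "(cell_mass \<sigma> h (u + real k * h))\<^sup>2 \<le> M * (1 + L) * exp (\<sigma> - \<beta>) * S (u + real k * h)"
    if k: "k < K" for k
  proof -
    define x where "x = u + real k * h"
    have Lx: "h * exp ((1 - \<beta>) * x) \<le> L" using L[OF k] by (simp add: x_def)
    have L0: "0 \<le> L" using Lx h by (meson exp_ge_zero less_imp_le mult_nonneg_nonneg order_trans)
    have "cell_mass \<sigma> h x \<le> M * (h * exp x + exp (\<beta> * x)) * exp (- (\<sigma> * x))"
      unfolding M_def using h \<sigma> beta by (intro cell_mass_le) auto
    also have "h * exp x + exp (\<beta> * x) = exp (\<beta> * x) * (1 + h * exp ((1 - \<beta>) * x))"
      by (simp add: algebra_simps flip: exp_add)
    also have "M * (exp (\<beta> * x) * (1 + h * exp ((1 - \<beta>) * x))) * exp (- (\<sigma> * x))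
        \<le> M * (exp (\<beta> * x) * (1 + L)) * exp (- (\<sigma> * x))"
      using M Lx by (intro mult_right_mono mult_left_mono) auto
    also have "\<dots> = M * (1 + L) * exp ((\<beta> - \<sigma>) * x)"
      by (simp add: algebra_simps flip: exp_add)
    finally have "(cell_mass \<sigma> h x)\<^sup>2 \<le> M * (1 + L) * exp ((\<beta> - \<sigma>) * x) * cell_mass \<sigma> h x"
      unfolding power2_eq_square by (intro mult_right_mono cell_mass_nonneg)
    also have "\<dots> = M * (1 + L) * (exp ((\<beta> - \<sigma>) * x) * cell_mass \<sigma> h x)" by simp
    also have "\<dots> \<le> M * (1 + L) * (exp (\<sigma> - \<beta>) * S x)"
    proof (rule mult_left_mono)
      have "exp ((\<beta> - \<sigma>) * x) * cell_mass \<sigma> h x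
          = (\<Sum>j | x < lam j \<and> lam j \<le> x + h. a j * exp ((\<beta> - \<sigma>) * x - \<sigma> * lam j))"
        by (simp add: cell_mass_def sum_distrib_left exp_diff exp_minus divide_inverse mult_ac)
      also have "\<dots> \<le> (\<Sum>j | x < lam j \<and> lam j \<le> x + h. a j * exp ((\<sigma> - \<beta>) + (\<beta> - 2 * \<sigma>) * lam j))"
      proof (intro sum_mono mult_left_mono)
        fix j assume "j \<in> {j. x < lam j \<and> lam j \<le> x + h}"
        then have "(\<sigma> - \<beta>) * (lam j - x) \<le> (\<sigma> - \<beta>) * 1" using \<sigma> h by (intro mult_left_mono) auto
        then show "exp ((\<beta> - \<sigma>) * x - \<sigma> * lam j) \<le> exp ((\<sigma> - \<beta>) + (\<beta> - 2 * \<sigma>) * lam j)"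
          by (simp add: algebra_simps)
      qed (simp add: a_pos less_imp_le)
      also have "\<dots> = exp (\<sigma> - \<beta>) * S x"
        by (simp add: S_def sum_distrib_left exp_add mult_ac)
      finally show "exp ((\<beta> - \<sigma>) * x) * cell_mass \<sigma> h x \<le> exp (\<sigma> - \<beta>) * S x" .
    qed (use M L0 in simp)
    finally show ?thesis by (simp add: x_def mult.assoc)
  qed
  then have "(\<Sum>k<K. (cell_mass \<sigma> h (u + real k * h))\<^sup>2) \<le> (\<Sum>k<K. M * (1 + L) * exp (\<sigma> - \<beta>) * S (u + real k * h))"
    by (intro sum_mono) auto
  also have "\<dots> = M * (1 + L) * exp (\<sigma> - \<beta>) * (\<Sum>j | u < lam j \<and> lam j \<le> u + real K * h. a j * exp ((\<beta> - 2 * \<sigma>) * lam j))"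
    unfolding S_def sum_distrib_left[symmetric] sum_cells[OF h(1)] ..
  finally show ?thesis by (simp add: M_def)
qed

text \<open>
  The integration starts at $t_0$, and $\kappa$ measures the distance of the path from the pole at $1$.
\<close>

lemma mean_square_remainder_le:
  assumes \<sigma>: "\<sigma> > \<beta>" "r > 0" "r \<le> \<sigma> - \<beta>" "\<sigma> \<le> S"
    and t0: "0 \<le> t0" "t0 \<le> T"
    and \<kappa>: "\<kappa> > 0" "\<And>t. t \<ge> t0 \<Longrightarrow> \<kappa> * (1 + t\<^sup>2) \<le> (cmod (Complex \<sigma> t - 1))\<^sup>2"
    and T: "T \<ge> 2 * pi" and u0: "u0 \<le> ln T / (1 - \<beta>)"
  shows "1 / T * integral {t0..T} (\<lambda>t. (cmod (F (Complex \<sigma> t) - D u0 (Complex \<sigma> t)))\<^sup>2)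
    \<le> 4 * ((2 + 8 * pi\<^sup>2) * ((2 * \<rho> + 4 * C) * (1 + 2 * pi * exp 1) * exp S)
           + 2 * \<rho>\<^sup>2 * exp 2 / \<kappa> + (S\<^sup>2 + 1) * (2 * pi * C\<^sup>2 * (1 + 1 / (2 * r))) + 4 * C\<^sup>2)
      * ((\<Sum>j | u0 < lam j \<and> lam j \<le> ln T / (1 - \<beta>) + 1. a j * exp ((\<beta> - 2 * \<sigma>) * lam j))
          + exp ((1 + \<beta> - 2 * \<sigma>) * (ln T / (1 - \<beta>))))"
proof -
  define h where "h = 2 * pi / T"
  define U' where "U' = ln T / (1 - \<beta>)"
  define e where "e = exp ((1 + \<beta> - 2 * \<sigma>) * U')"
  define Q where "Q = (\<Sum>j | u0 < lam j \<and> lam j \<le> U' + 1. a j * exp ((\<beta> - 2 * \<sigma>) * lam j))"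
  have T1: "T \<ge> 1" using T pi_gt3 by linarith
  have h: "h > 0" "h \<le> 1" "2 * pi / h = T" using T T1 by (auto simp: h_def)
  have TU: "T = exp ((1 - \<beta>) * U')" using T1 beta by (simp add: U'_def)
  \<comment> \<open>The cut \<open>U\<close> has to be a grid point \<open>u0 + K h\<close>, so \<open>U'\<close> is rounded up.\<close>
  define K where "K = nat \<lceil>(U' - u0) / h\<rceil>"
  define U where "U = u0 + real K * h"
  have "(U' - u0) / h \<ge> 0" using u0 h by (simp add: U'_def)
  then have "(U' - u0) / h \<le> real K" "real K < (U' - u0) / h + 1"
    unfolding K_def by linarith+
  then have "U' - u0 \<le> real K * h" "real K * h \<le> U' - u0 + h"
    using h(1) by (simp_all add: field_simps)
  then have U: "U' \<le> U" "U \<le> U' + h" by (simp_all add: U_def)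
  have decay: "exp ((\<beta> - \<sigma>) * U) \<le> exp ((\<beta> - \<sigma>) * U')"
    using U \<sigma> by (simp add: mult_left_mono_neg)
  \<comment> \<open>Here the choice of U pays off: T = e^((1-\<beta>)\<open>U'\<close>) combines
    with the squared size of the remainder to give exactly \<open>e\<close>.\<close>
  have decay2: "T * exp (2 * (\<beta> - \<sigma>) * U) \<le> e"
  proof -
    have "T * exp (2 * (\<beta> - \<sigma>) * U) \<le> T * exp (2 * (\<beta> - \<sigma>) * U')"
      using U \<sigma> T1 by (intro mult_left_mono) (auto intro: mult_left_mono_neg)
    also have "\<dots> = e" unfolding TU e_def by (simp add: algebra_simps flip: exp_add)
    finally show ?thesis .
  qed

  obtain Y1 where Y1: "continuous_on UNIV Y1"
    "\<And>t. t \<in> {0..T} \<Longrightarrow> (cmod (D U (Complex \<sigma> t) - D u0 (Complex \<sigma> t)))\<^sup>2 \<le> Y1 t"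
    "integral {0..T} Y1 \<le> (2 + 8 * pi\<^sup>2) * T * (\<Sum>k<K. (cell_mass \<sigma> h (u0 + real k * h))\<^sup>2)"
    by (rule D_diff_mean_square[OF h(1), of u0 K \<sigma>]) (rule that, auto simp: h(3) U_def)
  \<comment> \<open>\<open>V\<close> lies so far out that the pointwise error beyond it, with |s|
    \<le> \<sigma> + T, drops below the boundary term at \<open>U\<close>. The 3 is the 2 from
    \<open>norm_F_minus_G_le\<close> plus 1 for the boundary value of R at \<open>V\<close>. How
    large \<open>K2\<close> becomes is irrelevant, as the bound for the integral up to
    \<open>V\<close> does not depend on it.\<close>
  have "((\<lambda>K. (3 + (\<sigma> + T) / (\<sigma> - \<beta>)) * exp ((\<beta> - \<sigma>) * h * real K)) \<longlongrightarrow> 0) sequentially"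
    using \<sigma> h by (intro filterlim_compose[OF tendsto_exp_neg_mult filterlim_real_sequentially])
      (auto intro: mult_neg_pos)
  then have "\<forall>\<^sub>F K in sequentially. (3 + (\<sigma> + T) / (\<sigma> - \<beta>)) * exp ((\<beta> - \<sigma>) * h * real K) < 1"
    by (rule order_tendstoD) simp
  then obtain K2 where K2: "(3 + (\<sigma> + T) / (\<sigma> - \<beta>)) * exp ((\<beta> - \<sigma>) * h * real K2) < 1"
    by (auto simp: eventually_sequentially)
  define V where "V = U + real K2 * h"
  have UV: "U \<le> V" using h by (simp add: V_def)
  have V: "(3 + (\<sigma> + T) / (\<sigma> - \<beta>)) * exp ((\<beta> - \<sigma>) * V) \<le> exp ((\<beta> - \<sigma>) * U)"
  proof -
    have "exp ((\<beta> - \<sigma>) * V) = exp ((\<beta> - \<sigma>) * h * real K2) * exp ((\<beta> - \<sigma>) * U)"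
      by (simp add: V_def algebra_simps flip: exp_add)
    then show ?thesis
      using mult_right_mono[OF less_imp_le[OF K2], of "exp ((\<beta> - \<sigma>) * U)"] by (simp add: mult.assoc)
  qed
  obtain Y3 where Y3: "continuous_on UNIV Y3"
    "\<And>t. (cmod (integral {U..V} (\<lambda>x. of_real (R x) * exp (- (Complex \<sigma> t * of_real x)))))\<^sup>2 \<le> Y3 t"
    "integral {0..T} Y3 \<le> 2 * pi * C\<^sup>2 * exp (2 * (\<beta> - \<sigma>) * U) * (h + 1 / (2 * (\<sigma> - \<beta>)))"
    by (rule R_exp_mean_square[OF h(1) \<sigma>(1), of U K2]) (rule that, auto simp: h(3) V_def)

  define p where "p = \<rho>\<^sup>2 * exp (2 * (1 - \<sigma>) * U) / \<kappa>"
  define q where "q = (S\<^sup>2 + 1) * T\<^sup>2"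
  define c where "c = 4 * C\<^sup>2 * exp (2 * (\<beta> - \<sigma>) * U)"
  have p: "p \<ge> 0" using \<kappa> by (simp add: p_def)
  have q: "q \<ge> 0" by (simp add: q_def)
  have ne1: "Complex \<sigma> t \<noteq> 1" if "t \<ge> t0" for t
  proof
    assume "Complex \<sigma> t = 1"
    then have "\<kappa> * (1 + t\<^sup>2) \<le> 0" using \<kappa>(2)[OF that] by simp
    moreover have "\<kappa> * (1 + t\<^sup>2) > 0" using \<kappa>(1) by (simp add: add_pos_nonneg)
    ultimately show False by simp
  qed
  have pointwise: "(cmod (F (Complex \<sigma> t) - D u0 (Complex \<sigma> t)))\<^sup>2
      \<le> 4 * (Y1 t + p * inverse (1 + t\<^sup>2) + q * Y3 t + c)" if t: "t \<in> {t0..T}" for t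
  proof -
    define s where "s = Complex \<sigma> t"
    have s: "Re s = \<sigma>" "s \<noteq> 1" using ne1 t by (auto simp: s_def)
    have t': "0 \<le> t" "t \<le> T" using t t0 by auto
    define I where "I = integral {U..V} (\<lambda>x. of_real (R x) * exp (- (s * of_real x)))"
    define B where "B x = of_real (R x) * exp (- (s * of_real x))" for x
    define pole where "pole = of_real \<rho> * exp ((1 - s) * of_real U) / (s - 1)"
    have "s * I = integral {U..V} (\<lambda>x. s * of_real (R x) * exp (- (s * of_real x)))"
      unfolding I_def mult.assoc by (rule integral_mult_right[symmetric])
    also have "\<dots> = G V s - G U s - B V + B U"
      unfolding B_def by (rule integral_unique[OF has_integral_R_exp[OF UV s(2)]])
    \<comment> \<open>The four pieces: polynomial between \<open>u0\<close> and \<open>U\<close>,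
      pole term, integral of R, and a pointwise small rest. They are estimated by \<open>Y1\<close>,
      \<open>p\<close>, \<open>q\<close> times \<open>Y3\<close>, and \<open>c\<close>.\<close>
    finally have "F s - D u0 s = (D U s - D u0 s) + pole + s * I + (F s - G V s + B V - B U)"
      by (simp add: G_def pole_def)
    then have "(cmod (F s - D u0 s))\<^sup>2 \<le> 4 * ((cmod (D U s - D u0 s))\<^sup>2 + (cmod pole)\<^sup>2 + (cmod (s * I))\<^sup>2
        + (cmod (F s - G V s + B V - B U))\<^sup>2)"
      by (metis power2_norm_sum4_le)
    also have "\<dots> \<le> 4 * (Y1 t + p * inverse (1 + t\<^sup>2) + q * Y3 t + c)"
    proof (intro mult_left_mono add_mono)
      show "(cmod (D U s - D u0 s))\<^sup>2 \<le> Y1 t" unfolding s_def using t' by (intro Y1(2)) auto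
      have "(cmod pole)\<^sup>2 = \<rho>\<^sup>2 * exp (2 * (1 - \<sigma>) * U) / (cmod (s - 1))\<^sup>2"
        by (simp add: pole_def norm_divide norm_mult s power_divide power_mult_distrib)
           (simp add: power2_eq_square algebra_simps flip: exp_add)
      also have "\<dots> \<le> \<rho>\<^sup>2 * exp (2 * (1 - \<sigma>) * U) / (\<kappa> * (1 + t\<^sup>2))"
        using \<kappa>(2)[of t] \<kappa>(1) t s(2) unfolding s_def
        by (intro divide_left_mono mult_pos_pos) (auto simp: add_pos_nonneg)
      also have "\<dots> = p * inverse (1 + t\<^sup>2)" by (simp add: p_def divide_inverse)
      finally show "(cmod pole)\<^sup>2 \<le> p * inverse (1 + t\<^sup>2)" .
      have "\<sigma>\<^sup>2 \<le> S\<^sup>2" using \<sigma> beta by (intro power_mono) auto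
      also have "S\<^sup>2 * 1 \<le> S\<^sup>2 * T\<^sup>2" using T1 by (intro mult_left_mono) auto
      finally have "\<sigma>\<^sup>2 \<le> S\<^sup>2 * T\<^sup>2" by simp
      moreover have "t\<^sup>2 \<le> T\<^sup>2" using t' by (intro power_mono) auto
      ultimately have "(cmod s)\<^sup>2 \<le> q" by (simp add: s_def cmod_power2 q_def algebra_simps)
      then show "(cmod (s * I))\<^sup>2 \<le> q * Y3 t"
        using Y3(2)[of t] q unfolding norm_mult power_mult_distrib I_def s_def by (intro mult_mono) auto
      have "cmod s \<le> \<sigma> + T" using cmod_le[of s] t' \<sigma> beta by (simp add: s_def)
      then have "cmod s / (\<sigma> - \<beta>) \<le> (\<sigma> + T) / (\<sigma> - \<beta>)" using \<sigma> by (intro divide_right_mono) auto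
      then have "C * (2 + cmod s / (\<sigma> - \<beta>)) * exp ((\<beta> - \<sigma>) * V) \<le> C * (2 + (\<sigma> + T) / (\<sigma> - \<beta>)) * exp ((\<beta> - \<sigma>) * V)"
        using C_nonneg by (intro mult_right_mono mult_left_mono) auto
      then have 1: "cmod (F s - G V s) \<le> C * (2 + (\<sigma> + T) / (\<sigma> - \<beta>)) * exp ((\<beta> - \<sigma>) * V)"
        using norm_F_minus_G_le[of s V] s \<sigma> by simp
      have 2: "cmod (B V) \<le> C * exp ((\<beta> - \<sigma>) * V)" "cmod (B U) \<le> C * exp ((\<beta> - \<sigma>) * U)"
        unfolding B_def using norm_R_exp_le[of _ s] s by auto
      have "cmod (F s - G V s + B V - B U) \<le> cmod (F s - G V s) + cmod (B V) + cmod (B U)"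
        by (smt (verit) norm_triangle_ineq norm_triangle_ineq4)
      also have "\<dots> \<le> C * ((3 + (\<sigma> + T) / (\<sigma> - \<beta>)) * exp ((\<beta> - \<sigma>) * V)) + C * exp ((\<beta> - \<sigma>) * U)"
        using 1 2 by (simp add: algebra_simps)
      also have "\<dots> \<le> C * exp ((\<beta> - \<sigma>) * U) + C * exp ((\<beta> - \<sigma>) * U)"
        using V C_nonneg by (intro add_right_mono mult_left_mono) auto
      finally have "(cmod (F s - G V s + B V - B U))\<^sup>2 \<le> (2 * C * exp ((\<beta> - \<sigma>) * U))\<^sup>2"
        by (intro power_mono) auto
      also have "\<dots> = c"
        by (simp add: c_def power2_eq_square algebra_simps flip: exp_add)
      finally show "(cmod (F s - G V s + B V - B U))\<^sup>2 \<le> c" .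
    qed simp
    finally show ?thesis by (simp add: s_def)
  qed

  have pos: "0 \<le> Y1 t" "0 \<le> Y3 t" if "t \<in> {0..T}" for t
    using Y1(2)[OF that] Y3(2)[of t] by (meson order_trans zero_le_power2)+
  have Yi: "Y integrable_on {x..y}" if "continuous_on UNIV Y" for Y :: "real \<Rightarrow> real" and x y
    using that by (intro integrable_continuous_real) (rule continuous_on_subset, auto)
  have "integral {t0..T} (\<lambda>t. (cmod (F (Complex \<sigma> t) - D u0 (Complex \<sigma> t)))\<^sup>2)
      \<le> integral {t0..T} (\<lambda>t. 4 * (Y1 t + p * inverse (1 + t\<^sup>2) + q * Y3 t + c))"
  proof (rule integral_le)
    have "continuous_on {t0..T} (\<lambda>t. F (Complex \<sigma> t))"
      by (rule continuous_on_compose2[OF holomorphic_on_imp_continuous_on[OF F_holomorphic]])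
        (use ne1 \<sigma> in \<open>auto intro!: continuous_intros\<close>)
    then show "(\<lambda>t. (cmod (F (Complex \<sigma> t) - D u0 (Complex \<sigma> t)))\<^sup>2) integrable_on {t0..T}"
      unfolding D_def by (intro integrable_continuous_real continuous_intros)
    show "(\<lambda>t. 4 * (Y1 t + p * inverse (1 + t\<^sup>2) + q * Y3 t + c)) integrable_on {t0..T}"
      by (intro integrable_on_mult_right integrable_add Yi Y1 Y3 integrable_const_ivl
          has_integral_integrable[OF integral_inverse_square_le(1)[OF t0]])
  qed (rule pointwise)
  also have "\<dots> = 4 * (integral {t0..T} Y1 + p * (arctan T - arctan t0) + q * integral {t0..T} Y3 + c * (T - t0))"
  proof (rule integral_unique)
    have "((\<lambda>t. c) has_integral c * (T - t0)) {t0..T}"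
      using has_integral_const_real[of c t0 T] t0 by (simp add: mult.commute)
    then show "((\<lambda>t. 4 * (Y1 t + p * inverse (1 + t\<^sup>2) + q * Y3 t + c)) has_integral
       4 * (integral {t0..T} Y1 + p * (arctan T - arctan t0) + q * integral {t0..T} Y3 + c * (T - t0))) {t0..T}"
      by (intro has_integral_mult_right has_integral_add integral_inverse_square_le(1)[OF t0]
          integrable_integral Yi Y1 Y3)
  qed
  also have "\<dots> \<le> 4 * (integral {0..T} Y1 + p * 2 + q * integral {0..T} Y3 + c * T)"
    using pos t0 p q integral_inverse_square_le(2)[OF t0]
    by (intro mult_left_mono add_mono integral_subset_le Yi Y1 Y3) (auto simp: c_def)
  also have "\<dots> \<le> 4 * ((2 + 8 * pi\<^sup>2) * ((2 * \<rho> + 4 * C) * (1 + 2 * pi * exp 1) * exp S) * Q * T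
      + 2 * \<rho>\<^sup>2 * exp 2 / \<kappa> * e * T + (S\<^sup>2 + 1) * (2 * pi * C\<^sup>2 * (1 + 1 / (2 * r))) * e * T + 4 * C\<^sup>2 * e * T)"
  proof (intro mult_left_mono add_mono)
    have "(\<Sum>k<K. (cell_mass \<sigma> h (u0 + real k * h))\<^sup>2)
      \<le> (2 * \<rho> + 4 * C) * (1 + 2 * pi * exp 1) * exp (\<sigma> - \<beta>) * (\<Sum>j | u0 < lam j \<and> lam j \<le> u0 + real K * h. a j * exp ((\<beta> - 2 * \<sigma>) * lam j))"
    \<comment> \<open>With L = 2 pi e: every left end is at most \<open>U'\<close> + 1, where
      e^((1-\<beta>)x) is at most e T, and h T = 2 pi.\<close>
    proof (rule cell_mass_squares_le[OF h(1,2) \<sigma>(1)])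
      fix k assume "k < K"
      then have "real k * h \<le> real K * h" using h by (intro mult_right_mono) auto
      then have "u0 + real k * h \<le> U' + 1" using U h unfolding U_def by linarith
      then have "(1 - \<beta>) * (u0 + real k * h) \<le> (1 - \<beta>) * (U' + 1)" using beta by (intro mult_left_mono) auto
      also have "\<dots> \<le> (1 - \<beta>) * U' + 1" using beta by (simp add: algebra_simps)
      finally have "exp ((1 - \<beta>) * (u0 + real k * h)) \<le> T * exp 1"
        unfolding TU by (simp flip: exp_add)
      then have "h * exp ((1 - \<beta>) * (u0 + real k * h)) \<le> h * (T * exp 1)"
        using h by (intro mult_left_mono) auto
      also have "\<dots> = 2 * pi * exp 1" using T1 by (simp add: h_def)
      finally show "h * exp ((1 - \<beta>) * (u0 + real k * h)) \<le> 2 * pi * exp 1" .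
    qed
    also have "\<dots> \<le> (2 * \<rho> + 4 * C) * (1 + 2 * pi * exp 1) * exp S * Q"
      unfolding Q_def
    proof (intro mult_mono mult_left_mono sum_mono2 finite_cell)
      show "{j. u0 < lam j \<and> lam j \<le> u0 + real K * h} \<subseteq> {j. u0 < lam j \<and> lam j \<le> U' + 1}"
        using U h by (auto simp: U_def)
    qed (use \<sigma> beta rho_pos C_nonneg a_pos in \<open>auto intro!: sum_nonneg mult_nonneg_nonneg simp: less_imp_le\<close>)
    finally have "(2 + 8 * pi\<^sup>2) * T * (\<Sum>k<K. (cell_mass \<sigma> h (u0 + real k * h))\<^sup>2)
       \<le> (2 + 8 * pi\<^sup>2) * T * ((2 * \<rho> + 4 * C) * (1 + 2 * pi * exp 1) * exp S * Q)"
      using T1 by (intro mult_left_mono) auto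
    with Y1(3) show "integral {0..T} Y1 \<le> (2 + 8 * pi\<^sup>2) * ((2 * \<rho> + 4 * C) * (1 + 2 * pi * exp 1) * exp S) * Q * T"
      by (simp add: mult_ac)
  next
    \<comment> \<open>Rounding the cut up by at most h \<le> 1 costs the factor e^2. The remaining
      e^(2(1-\<sigma>)\<open>U'\<close>) equals \<open>e * T\<close>.\<close>
    have "(1 - \<sigma>) * (U - U') \<le> 1 * (U - U')" using U \<sigma> beta by (intro mult_right_mono) auto
    then have "(1 - \<sigma>) * U \<le> (1 - \<sigma>) * U' + 1" using U h by (simp add: algebra_simps)
    then have "exp (2 * (1 - \<sigma>) * U) \<le> exp (2 * (1 - \<sigma>) * U' + 2)"
      unfolding exp_le_cancel_iff mult.assoc by linarith
    also have "\<dots> = exp 2 * e * T" unfolding e_def TU by (simp add: algebra_simps flip: exp_add)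
    finally have "\<rho>\<^sup>2 / \<kappa> * exp (2 * (1 - \<sigma>) * U) \<le> \<rho>\<^sup>2 / \<kappa> * (exp 2 * e * T)"
      using \<kappa>(1) by (intro mult_left_mono) auto
    then have "2 * (\<rho>\<^sup>2 / \<kappa> * exp (2 * (1 - \<sigma>) * U)) \<le> 2 * (\<rho>\<^sup>2 / \<kappa> * (exp 2 * e * T))"
      by (rule mult_left_mono) simp
    then show "p * 2 \<le> 2 * \<rho>\<^sup>2 * exp 2 / \<kappa> * e * T" by (simp add: p_def mult_ac)
  next
    have "h + 1 / (2 * (\<sigma> - \<beta>)) \<le> 1 + 1 / (2 * r)"
      using h \<sigma> by (intro add_mono divide_left_mono) auto
    then have Y3': "2 * pi * C\<^sup>2 * exp (2 * (\<beta> - \<sigma>) * U) * (h + 1 / (2 * (\<sigma> - \<beta>)))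
       \<le> 2 * pi * C\<^sup>2 * exp (2 * (\<beta> - \<sigma>) * U) * (1 + 1 / (2 * r))"
      by (intro mult_left_mono) auto
    have "q * integral {0..T} Y3 \<le> q * (2 * pi * C\<^sup>2 * exp (2 * (\<beta> - \<sigma>) * U) * (1 + 1 / (2 * r)))"
      by (rule mult_left_mono[OF order_trans[OF Y3(3) Y3'] q])
    also have "\<dots> = (S\<^sup>2 + 1) * (2 * pi * C\<^sup>2 * (1 + 1 / (2 * r))) * T * (T * exp (2 * (\<beta> - \<sigma>) * U))"
      by (simp add: q_def power2_eq_square)
    also have "\<dots> \<le> (S\<^sup>2 + 1) * (2 * pi * C\<^sup>2 * (1 + 1 / (2 * r))) * T * e"
      using \<sigma> T1 by (intro mult_left_mono decay2) (auto intro!: mult_nonneg_nonneg add_nonneg_nonneg)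
    finally show "q * integral {0..T} Y3 \<le> (S\<^sup>2 + 1) * (2 * pi * C\<^sup>2 * (1 + 1 / (2 * r))) * e * T"
      by (simp add: mult_ac)
  next
    have "exp (2 * (\<beta> - \<sigma>) * U) \<le> T * exp (2 * (\<beta> - \<sigma>) * U)" using T1 by simp
    with decay2 have "exp (2 * (\<beta> - \<sigma>) * U) \<le> e" by linarith
    then show "c * T \<le> 4 * C\<^sup>2 * e * T"
      unfolding c_def using T1 by (intro mult_right_mono mult_left_mono) auto
  qed simp
  also have "\<dots> \<le> T * (4 * ((2 + 8 * pi\<^sup>2) * ((2 * \<rho> + 4 * C) * (1 + 2 * pi * exp 1) * exp S)
           + 2 * \<rho>\<^sup>2 * exp 2 / \<kappa> + (S\<^sup>2 + 1) * (2 * pi * C\<^sup>2 * (1 + 1 / (2 * r))) + 4 * C\<^sup>2) * (Q + e))"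
  proof -
    define c1 where "c1 = (2 + 8 * pi\<^sup>2) * ((2 * \<rho> + 4 * C) * (1 + 2 * pi * exp 1) * exp S)"
    define c2 where "c2 = 2 * \<rho>\<^sup>2 * exp 2 / \<kappa>"
    define c3 where "c3 = (S\<^sup>2 + 1) * (2 * pi * C\<^sup>2 * (1 + 1 / (2 * r)))"
    have c: "c1 \<ge> 0" "c2 \<ge> 0" "c3 \<ge> 0"
      using rho_pos C_nonneg \<kappa>(1) \<sigma> by (auto simp: c1_def c2_def c3_def intro!: mult_nonneg_nonneg add_nonneg_nonneg)
    have "Q \<ge> 0" unfolding Q_def using a_pos by (intro sum_nonneg) (simp add: less_imp_le)
    moreover have "e \<ge> 0" by (simp add: e_def)
    ultimately have "0 \<le> T * (4 * (c1 * e + (c2 + c3 + 4 * C\<^sup>2) * Q))" using c T1 by simp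
    then have "4 * (c1 * Q * T + c2 * e * T + c3 * e * T + 4 * C\<^sup>2 * e * T) \<le> T * (4 * (c1 + c2 + c3 + 4 * C\<^sup>2) * (Q + e))"
      by (simp add: algebra_simps)
    then show ?thesis by (simp only: c1_def c2_def c3_def)
  qed
  finally show ?thesis
    using T1 by (simp add: divide_le_eq mult.commute[of T] Q_def e_def U'_def)
qed

subsection \<open>Mean values on vertical lines\<close>

lemma is_continuation_F: "is_continuation (\<lambda>j. exp (lam j)) a \<beta> F"
proof -
  have "complex_of_real (exp (lam j)) powr (- s) = exp (- (s * of_real (lam j)))" for j s
    by (simp add: powr_def Ln_of_real del: of_real_exp)
  then show ?thesis unfolding is_continuation_def using F_holomorphic F_sums by simp
qed

text \<open>F witnesses that a continuation exists, so the chosen function is one too. The two agree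
  for Re s > 1, and the identity theorem carries this through the punctured half-plane, which is
  connected; the accumulation point used is 2.\<close>

lemma dirichlet_continuation_eq_F:
  assumes s: "Re s > \<beta>" "s \<noteq> 1"
  shows "dirichlet_continuation (\<lambda>j. exp (lam j)) a \<beta> s = F s"
proof -
  let ?f = "dirichlet_continuation (\<lambda>j. exp (lam j)) a \<beta>"
  let ?S = "{s. Re s > \<beta>} - {1::complex}"
  have f: "is_continuation (\<lambda>j. exp (lam j)) a \<beta> ?f"
    unfolding dirichlet_continuation_def by (rule someI[of _ F]) (rule is_continuation_F)
  have "open ?S" by (intro open_delete) (simp add: open_halfspace_Re_gt)
  moreover have "connected ?S"
    by (intro connected_open_delete) (auto simp: open_halfspace_Re_gt convex_halfspace_Re_gt convex_connected)
  moreover have "(\<lambda>s. ?f s - F s) holomorphic_on ?S"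
    using f F_holomorphic by (intro holomorphic_intros) (auto simp: is_continuation_def)
  moreover have "{s. Re s > 1} \<subseteq> ?S" using beta by auto
  moreover have "?f s - F s = 0" if "Re s > 1" for s
  proof -
    let ?t = "\<lambda>j. of_real (a j) * of_real (exp (lam j)) powr (- s)"
    have "?t sums ?f s" using f that unfolding is_continuation_def by blast
    moreover have "?t sums F s" using is_continuation_F that unfolding is_continuation_def by blast
    ultimately show ?thesis using sums_unique2 by force
  qed
  moreover have "2 \<in> {s. Re s > 1}" "2 \<in> ?S" "(2::complex) islimpt {s. Re s > 1}"
    using beta by (auto intro!: interior_limit_point simp: interior_open open_halfspace_Re_gt)
  ultimately have "?f s - F s = 0"
    using s by (intro analytic_continuation[of "\<lambda>s. ?f s - F s" ?S "{s. Re s > 1}" 2 s]) auto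
  then show ?thesis by simp
qed

text \<open>Read off from the convergence of the complex series at the real point \<tau>.\<close>

lemma summable_coeffs:
  assumes "\<tau> > 1" shows "summable (\<lambda>j. a j * exp (- (\<tau> * lam j)))"
proof -
  have "(\<lambda>j. of_real (a j * exp (- (\<tau> * lam j)))) sums F (of_real \<tau>)"
    using F_sums[of "of_real \<tau>"] assms by (simp flip: exp_of_real)
  then show ?thesis using sums_Re sums_summable by fastforce
qed

text \<open>A single coefficient is at most the mass of a cell ending at \<open>lam j\<close>, and
  the length of that cell is free.\<close>

lemma coeff_le: "a j \<le> 2 * (2 * \<rho> + 4 * C) * exp (\<beta> * lam j)"
proof -
  \<comment> \<open>The largest cell length for which the main term \<open>h exp (lam j)\<close> stays below the error term.\<close>
  define h where "h = min 1 (exp ((\<beta> - 1) * lam j))"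
  have h: "0 < h" "h \<le> 1" "h * exp (lam j) \<le> exp (\<beta> * lam j)"
  proof -
    have "h * exp (lam j) \<le> exp ((\<beta> - 1) * lam j) * exp (lam j)" by (intro mult_right_mono) (auto simp: h_def)
    then show "h * exp (lam j) \<le> exp (\<beta> * lam j)" by (simp add: algebra_simps flip: exp_add)
  qed (auto simp: h_def)
  define u where "u = lam j - h"
  have u: "u + h = lam j" "u < lam j" using h by (auto simp: u_def)
  have "a j + A u = (\<Sum>i\<in>insert j {i. lam i \<le> u}. a i)"
    using u by (subst sum.insert) (auto simp: A_def finite_le)
  also have "\<dots> \<le> A (u + h)"
    unfolding A_def u(1) using u a_pos by (intro sum_mono2 finite_le) (auto simp: less_imp_le)
  finally have "a j \<le> (2 * \<rho> + 4 * C) * (h * exp u + exp (\<beta> * u))"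
    using A_increment_le[of h u] h by simp
  also have "\<dots> \<le> (2 * \<rho> + 4 * C) * (exp (\<beta> * lam j) + exp (\<beta> * lam j))"
  proof (intro mult_left_mono add_mono)
    have "h * exp u \<le> h * exp (lam j)" using u h by (intro mult_left_mono) auto
    then show "h * exp u \<le> exp (\<beta> * lam j)" using h by linarith
    show "exp (\<beta> * u) \<le> exp (\<beta> * lam j)" using u beta by (simp add: mult_left_mono)
  qed (use rho_pos C_nonneg in simp)
  finally show ?thesis by (simp add: algebra_simps)
qed

text \<open>Bounding one of the two factors a_j by n_j^\<beta> leaves the series at the real point 2
  \<sigma> - \<beta>, which exceeds 1 exactly when \<sigma> > (1+\<beta>)/2.\<close>

lemma summable_coeff_squares:
  assumes \<sigma>: "\<sigma> > (1 + \<beta>) / 2" shows "summable (\<lambda>j. (a j * exp (- (\<sigma> * lam j)))\<^sup>2)"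
proof (rule summable_comparison_test')
  show "summable (\<lambda>j. 2 * (2 * \<rho> + 4 * C) * (a j * exp (- ((2 * \<sigma> - \<beta>) * lam j))))"
    using \<sigma> by (intro summable_mult summable_coeffs) (simp add: field_simps)
  fix j :: nat
  have "(a j * exp (- (\<sigma> * lam j)))\<^sup>2 = a j * (a j * exp (- (2 * \<sigma> * lam j)))"
    by (simp add: power2_eq_square algebra_simps flip: exp_add)
  also have "\<dots> \<le> 2 * (2 * \<rho> + 4 * C) * exp (\<beta> * lam j) * (a j * exp (- (2 * \<sigma> * lam j)))"
    using a_pos[of j] by (intro mult_right_mono coeff_le) auto
  also have "\<dots> = 2 * (2 * \<rho> + 4 * C) * (a j * exp (- ((2 * \<sigma> - \<beta>) * lam j)))"
    by (simp add: algebra_simps flip: exp_add)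
  finally show "norm ((a j * exp (- (\<sigma> * lam j)))\<^sup>2) \<le> 2 * (2 * \<rho> + 4 * C) * (a j * exp (- ((2 * \<sigma> - \<beta>) * lam j)))"
    by simp
qed

text \<open>The cut \<open>u0\<close> is fixed before T grows: it makes the tail of the majorant
  series small uniformly in T, while the remaining power of T has negative exponent. The tolerance e
  is split into quarters: the weighted mean square of the remainder, \<eta> times that of the
  polynomial, the latter against its limit, and that limit against the full sum.\<close>

lemma mean_square_limit:
  assumes \<sigma>: "\<sigma> > (1 + \<beta>) / 2"
  defines "t0 \<equiv> if \<sigma> = 1 then 1 else 0"
  shows "((\<lambda>T. 1 / T * integral {t0..T} (\<lambda>t. (cmod (F (Complex \<sigma> t)))\<^sup>2))
    \<longlongrightarrow> (\<Sum>j. (a j * exp (- (\<sigma> * lam j)))\<^sup>2)) at_top"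
proof (rule tendstoI)
  fix e :: real assume e: "e > 0"
  define b where "b j = a j * exp (- (\<sigma> * lam j))" for j
  define q where "q j = a j * exp (- ((2 * \<sigma> - \<beta>) * lam j))" for j
  \<comment> \<open>For \<sigma> = 1 and t \<ge> 1 one has t^2 \<ge> (1+t^2)/2; otherwise the line
    avoids the pole and its distance |\<sigma> - 1| enters.\<close>
  define \<kappa> where "\<kappa> = (if \<sigma> = 1 then 1 / 2 else min 1 ((\<sigma> - 1)\<^sup>2))"
  have \<sigma>\<beta>: "\<sigma> > \<beta>" using \<sigma> beta by (simp add: field_simps)
  have t0: "t0 \<ge> 0" by (simp add: t0_def)
  have \<kappa>: "\<kappa> > 0" "\<kappa> * (1 + t\<^sup>2) \<le> (cmod (Complex \<sigma> t - 1))\<^sup>2" if "t \<ge> t0" for t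
  proof -
    show "\<kappa> > 0" by (simp add: \<kappa>_def)
    show "\<kappa> * (1 + t\<^sup>2) \<le> (cmod (Complex \<sigma> t - 1))\<^sup>2"
    proof (cases "\<sigma> = 1")
      case True
      then have "1 \<le> t\<^sup>2" using that by (simp add: t0_def one_le_power)
      then show ?thesis using True by (simp add: \<kappa>_def cmod_power2)
    next
      case False
      then have "\<kappa> \<le> (\<sigma> - 1)\<^sup>2" "\<kappa> * t\<^sup>2 \<le> 1 * t\<^sup>2"
        by (simp add: \<kappa>_def) (intro mult_right_mono, auto simp: \<kappa>_def False)
      then show ?thesis by (simp add: cmod_power2 distrib_left)
    qed
  qed
  define E where "E = 4 * ((2 + 8 * pi\<^sup>2) * ((2 * \<rho> + 4 * C) * (1 + 2 * pi * exp 1) * exp \<sigma>)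
           + 2 * \<rho>\<^sup>2 * exp 2 / \<kappa> + (\<sigma>\<^sup>2 + 1) * (2 * pi * C\<^sup>2 * (1 + 1 / (2 * (\<sigma> - \<beta>)))) + 4 * C\<^sup>2)"
  have E: "E \<ge> 0"
    unfolding E_def using rho_pos C_nonneg \<kappa>(1)[of t0] \<sigma>\<beta>
    by (intro mult_nonneg_nonneg add_nonneg_nonneg) auto
  have sum_b: "summable (\<lambda>j. (b j)\<^sup>2)" unfolding b_def by (rule summable_coeff_squares[OF \<sigma>])
  define S where "S = (\<Sum>j. (b j)\<^sup>2)"
  have S: "S \<ge> 0" unfolding S_def by (intro suminf_nonneg sum_b) auto
  have sum_q: "summable q" unfolding q_def using \<sigma> by (intro summable_coeffs) (simp add: field_simps)
  \<comment> \<open>For large T the polynomial has mean square at most \<open>S + 1\<close>, so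
    \<eta> times it is at most e/4.\<close>
  define \<eta> where "\<eta> = e / (4 * (S + 1))"
  have \<eta>: "\<eta> > 0" using e S by (simp add: \<eta>_def)
  define E' where "E' = (1 + 1 / \<eta>) * E"
  have E': "E' \<ge> 0" using E \<eta> by (simp add: E'_def)

  have "(\<lambda>J. \<Sum>j<J. (b j)\<^sup>2) \<longlonglongrightarrow> S" unfolding S_def by (rule summable_LIMSEQ[OF sum_b])
  then have "\<forall>\<^sub>F J in sequentially. dist (\<Sum>j<J. (b j)\<^sup>2) S < e / 4" using e by (intro tendstoD) auto
  moreover have "(\<lambda>J. E' * (suminf q - (\<Sum>j<J. q j))) \<longlonglongrightarrow> E' * (suminf q - suminf q)"
    by (intro tendsto_intros summable_LIMSEQ sum_q)
  then have "\<forall>\<^sub>F J in sequentially. E' * (suminf q - (\<Sum>j<J. q j)) < e / 8"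
    using e by (intro order_tendstoD(2)) auto
  ultimately have "\<forall>\<^sub>F J in sequentially. dist (\<Sum>j<J. (b j)\<^sup>2) S < e / 4 \<and>
      E' * (suminf q - (\<Sum>j<J. q j)) < e / 8 \<and> J > 0"
    using eventually_gt_at_top[of 0] by eventually_elim auto
  then obtain J where J: "dist (\<Sum>j<J. (b j)\<^sup>2) S < e / 4" "E' * (suminf q - (\<Sum>j<J. q j)) < e / 8" "J > 0"
    by (auto simp: eventually_sequentially)
  \<comment> \<open>The cut keeps exactly the first \<open>J\<close> terms; \<open>J > 0\<close>
    prevents the truncated subtraction from keeping one term too many.\<close>
  define u0 where "u0 = lam (J - 1)"
  have le_u0: "lam j \<le> u0 \<longleftrightarrow> j < J" for j
    using strict_mono_less_eq[OF lam_mono, of j "J - 1"] J(3) by (auto simp: u0_def)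
  have D_u0: "D u0 (Complex \<sigma> t) = (\<Sum>j<J. of_real (b j) * cis (- (t * lam j)))" for t
    unfolding D_def le_u0 exp_neg_Complex b_def lessThan_def by (simp add: mult.assoc)
  define mF where "mF T = 1 / T * integral {t0..T} (\<lambda>t. (cmod (F (Complex \<sigma> t)))\<^sup>2)" for T
  define mP where "mP T = 1 / T * integral {t0..T} (\<lambda>t. (cmod (D u0 (Complex \<sigma> t)))\<^sup>2)" for T
  define mR where "mR T = 1 / T * integral {t0..T} (\<lambda>t. (cmod (F (Complex \<sigma> t) - D u0 (Complex \<sigma> t)))\<^sup>2)" for T
  have "(mP \<longlongrightarrow> (\<Sum>j<J. (b j)\<^sup>2)) at_top"
    unfolding mP_def D_u0 using strict_mono_imp_inj_on[OF lam_mono] by (rule mean_square_exp_sum)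
  then have ev1: "\<forall>\<^sub>F T in at_top. dist (mP T) (\<Sum>j<J. (b j)\<^sup>2) < min 1 (e / 4)"
    using e by (intro tendstoD) auto
  have ln_top: "filterlim (\<lambda>T. ln T / (1 - \<beta>)) at_top (at_top :: real filter)"
    using filterlim_tendsto_pos_mult_at_top[OF tendsto_const _ ln_at_top, of "1 / (1 - \<beta>)"] beta by simp
  have "((\<lambda>T. E' * exp ((1 + \<beta> - 2 * \<sigma>) * (ln T / (1 - \<beta>)))) \<longlongrightarrow> 0) at_top"
    using \<sigma> by (intro filterlim_compose[OF tendsto_exp_neg_mult ln_top]) (simp add: field_simps)
  then have ev2: "\<forall>\<^sub>F T in at_top. E' * exp ((1 + \<beta> - 2 * \<sigma>) * (ln T / (1 - \<beta>))) < e / 8"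
    using e by (intro order_tendstoD(2)) auto
  have ev3: "\<forall>\<^sub>F T in at_top. u0 \<le> ln T / (1 - \<beta>)"
    using ln_top by (simp add: filterlim_at_top)
  show "\<forall>\<^sub>F T in at_top. dist (1 / T * integral {t0..T} (\<lambda>t. (cmod (F (Complex \<sigma> t)))\<^sup>2))
      (\<Sum>j. (a j * exp (- (\<sigma> * lam j)))\<^sup>2) < e"
    using ev1 ev2 ev3 eventually_ge_at_top[of "2 * pi"]
  proof eventually_elim
    case (elim T)
    have T: "T > 0" "t0 \<le> T" using elim(4) pi_gt3 by (auto simp: t0_def)
    have "mR T \<le> E * ((\<Sum>j | u0 < lam j \<and> lam j \<le> ln T / (1 - \<beta>) + 1. a j * exp ((\<beta> - 2 * \<sigma>) * lam j))
          + exp ((1 + \<beta> - 2 * \<sigma>) * (ln T / (1 - \<beta>))))"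
      unfolding mR_def E_def
      using \<sigma>\<beta> elim T t0 \<kappa> by (intro mean_square_remainder_le) auto
    also have "\<dots> \<le> E * ((suminf q - (\<Sum>j<J. q j)) + exp ((1 + \<beta> - 2 * \<sigma>) * (ln T / (1 - \<beta>))))"
    proof (intro mult_left_mono add_right_mono E)
      let ?X = "{j. u0 < lam j \<and> lam j \<le> ln T / (1 - \<beta>) + 1}"
      \<comment> \<open>The points beyond \<open>u0\<close> have index at least \<open>J\<close>, so
        their sum is bounded by a tail of the series, independently of T.\<close>
      have "sum q ?X + sum q {..<J} = sum q (?X \<union> {..<J})"
        by (intro sum.union_disjoint[symmetric] finite_cell) (auto simp: le_u0[symmetric])
      also have "\<dots> \<le> suminf q"
        using a_pos by (intro sum_le_suminf sum_q) (auto simp: finite_cell q_def less_imp_le)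
      finally show "(\<Sum>j\<in>?X. a j * exp ((\<beta> - 2 * \<sigma>) * lam j)) \<le> suminf q - (\<Sum>j<J. q j)"
        by (simp add: q_def algebra_simps)
    qed
    finally have "(1 + 1 / \<eta>) * mR T \<le> E' * ((suminf q - (\<Sum>j<J. q j)) + exp ((1 + \<beta> - 2 * \<sigma>) * (ln T / (1 - \<beta>))))"
      unfolding E'_def mult.assoc using \<eta> by (intro mult_left_mono) auto
    then have mR: "(1 + 1 / \<eta>) * mR T < e / 4"
      using J(2) elim(2) by (simp add: distrib_left)
    have ne1: "Complex \<sigma> t \<noteq> 1" if "t \<ge> t0" for t
      using that by (auto simp: complex_eq_iff t0_def)
    have contF: "continuous_on {t0..T} (\<lambda>t. F (Complex \<sigma> t))"
      by (rule continuous_on_compose2[OF holomorphic_on_imp_continuous_on[OF F_holomorphic]])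
        (use ne1 \<sigma>\<beta> in \<open>auto intro!: continuous_intros\<close>)
    have contD: "continuous_on {t0..T} (\<lambda>t. D u0 (Complex \<sigma> t))"
      unfolding D_def by (intro continuous_intros)
    have "\<bar>integral {t0..T} (\<lambda>t. (cmod (F (Complex \<sigma> t)))\<^sup>2 - (cmod (D u0 (Complex \<sigma> t)))\<^sup>2)\<bar>
       \<le> integral {t0..T} (\<lambda>t. (1 + 1 / \<eta>) * (cmod (F (Complex \<sigma> t) - D u0 (Complex \<sigma> t)))\<^sup>2 + \<eta> * (cmod (D u0 (Complex \<sigma> t)))\<^sup>2)"
      unfolding real_norm_def[symmetric]
      by (intro integral_norm_bound_integral integrable_continuous_real continuous_intros contF contD)
        (use norm_square_diff_le[OF \<eta>] in auto)
    also have "\<dots> = (1 + 1 / \<eta>) * (T * mR T) + \<eta> * (T * mP T)"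
      using T by (subst integral_add)
        (auto intro!: integrable_continuous_real continuous_intros contF contD simp: mR_def mP_def)
    finally have "T * \<bar>mF T - mP T\<bar> \<le> (1 + 1 / \<eta>) * (T * mR T) + \<eta> * (T * mP T)"
      using T
      by (subst (asm) integral_diff)
        (auto intro!: integrable_continuous_real continuous_intros contF contD
          simp: mF_def mP_def abs_mult[symmetric] diff_divide_distrib[symmetric])
    also have "\<dots> = T * ((1 + 1 / \<eta>) * mR T + \<eta> * mP T)" by (simp add: algebra_simps)
    finally have diff: "\<bar>mF T - mP T\<bar> \<le> (1 + 1 / \<eta>) * mR T + \<eta> * mP T" using T by simp
    have "(\<Sum>j<J. (b j)\<^sup>2) \<le> S" unfolding S_def by (intro sum_le_suminf sum_b) auto
    moreover have mP: "\<bar>mP T - (\<Sum>j<J. (b j)\<^sup>2)\<bar> < 1" "\<bar>mP T - (\<Sum>j<J. (b j)\<^sup>2)\<bar> < e / 4"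
      using elim(1) by (auto simp: dist_real_def)
    ultimately have "mP T \<le> S + 1" by linarith
    then have "\<eta> * mP T \<le> \<eta> * (S + 1)" using \<eta> by (intro mult_left_mono) auto
    also have "\<dots> = e / 4" using S by (simp add: \<eta>_def field_simps)
    finally have "\<bar>mF T - mP T\<bar> < e / 2" using diff mR by linarith
    then have "\<bar>mF T - S\<bar> < e" using mP(2) J(1) unfolding dist_real_def by linarith
    then show ?case by (simp add: dist_real_def mF_def S_def b_def)
  qed
qed

text \<open>With \<open>u0\<close> below every frequency the polynomial up to \<open>u0\<close> is
  empty and the remainder is F itself. The range of \<sigma> stays at distance at least
  (1-\<beta>)/2 from the pole and \<delta> from the line \<beta>, so all constants are uniform. The
  linear sum is then bounded by unit cells whose masses grow like e^(\<epsilon> m).\<close>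

lemma mean_square_bound:
  assumes \<delta>: "\<delta> > 0"
  shows "\<exists>C' T0. \<forall>\<sigma> T. \<beta> + \<delta> \<le> \<sigma> \<longrightarrow> \<sigma> \<le> (1 + \<beta>) / 2 \<longrightarrow> T \<ge> T0 \<longrightarrow>
    1 / T * integral {0..T} (\<lambda>t. (cmod (F (Complex \<sigma> t)))\<^sup>2)
      \<le> C' * exp_growth (1 + \<beta> - 2 * \<sigma>) (ln T / (1 - \<beta>))"
proof -
  define \<kappa> where "\<kappa> = ((1 - \<beta>) / 2)\<^sup>2"
  define u0 where "u0 = lam 0 - 1"
  define w where "w = \<bar>u0\<bar>"
  define c where "c = w + 3"
  define M where "M = 2 * \<rho> + 4 * C"
  define E where "E = 4 * ((2 + 8 * pi\<^sup>2) * ((2 * \<rho> + 4 * C) * (1 + 2 * pi * exp 1) * exp 1)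
           + 2 * \<rho>\<^sup>2 * exp 2 / \<kappa> + (1\<^sup>2 + 1) * (2 * pi * C\<^sup>2 * (1 + 1 / (2 * \<delta>))) + 4 * C\<^sup>2)"
  have \<kappa>: "\<kappa> > 0" "\<kappa> \<le> 1" using beta by (auto simp: \<kappa>_def power_le_one)
  have M: "M \<ge> 0" using rho_pos C_nonneg by (simp add: M_def)
  have E: "E \<ge> 0"
    unfolding E_def using rho_pos C_nonneg \<kappa> \<delta> by (intro mult_nonneg_nonneg add_nonneg_nonneg) auto
  have no_terms: "{j. lam j \<le> u0} = {}"
  proof -
    have "u0 < lam j" for j
      using strict_mono_less_eq[OF lam_mono, of 0 j] by (simp add: u0_def)
    then show ?thesis by (auto simp: not_le)
  qed
  show ?thesis
  \<comment> \<open>The threshold does not depend on \<sigma>: T \<ge> 2 pi makes the cell length at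
    most 1, and log T \<ge> 1 + \<open>w\<close> makes U at least 1 and at least
    \<open>u0\<close>.\<close>
  proof (rule exI[of _ "E * (2 * M * exp (2 * w) * (1 + 2 * (c * exp c)) + 2)"],
      rule exI[of _ "max (2 * pi) (exp (1 + w))"], intro allI impI)
    fix \<sigma> T assume \<sigma>: "\<beta> + \<delta> \<le> \<sigma>" "\<sigma> \<le> (1 + \<beta>) / 2" and T: "T \<ge> max (2 * pi) (exp (1 + w))"
    define U where "U = ln T / (1 - \<beta>)"
    define \<epsilon> where "\<epsilon> = 1 + \<beta> - 2 * \<sigma>"
    have \<epsilon>: "0 \<le> \<epsilon>" "\<epsilon> \<le> 1" using \<sigma> \<delta> beta by (auto simp: \<epsilon>_def)
    have T': "T \<ge> 2 * pi" "T \<ge> exp (1 + w)" "T > 0"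
      using T less_le_trans[OF exp_gt_zero, of "1 + w" T] by auto
    have lnT: "ln T \<ge> 1 + w" using T' by (simp add: ln_ge_iff)
    have "w \<ge> 0" by (simp add: w_def)
    have "ln T * (1 - \<beta>) \<le> ln T" using lnT \<open>w \<ge> 0\<close> beta by (simp add: mult_left_le)
    then have "U \<ge> ln T" unfolding U_def using beta by (simp add: le_divide_eq)
    then have U: "U \<ge> 1" "U \<ge> u0" "U \<ge> 0" using lnT by (auto simp: w_def)
    have grow: "exp (\<epsilon> * U) \<le> 2 * exp_growth \<epsilon> U" using \<epsilon> U by (intro exp_le_exp_growth)
    have pole: "\<kappa> * (1 + t\<^sup>2) \<le> (cmod (Complex \<sigma> t - 1))\<^sup>2" for t
    proof -
      have "((1 - \<beta>) / 2)\<^sup>2 \<le> (1 - \<sigma>)\<^sup>2" using \<sigma> beta by (intro power_mono) (auto simp: field_simps)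
      then have "\<kappa> \<le> (\<sigma> - 1)\<^sup>2" by (simp add: \<kappa>_def power2_commute)
      moreover have "\<kappa> * t\<^sup>2 \<le> 1 * t\<^sup>2" using \<kappa> by (intro mult_right_mono) auto
      ultimately show ?thesis by (simp add: cmod_power2 distrib_left)
    qed
    \<comment> \<open>The number of unit cells from \<open>u0\<close> that reach
      \<open>U + 1\<close>; rounding and \<bar>\<open>u0\<close>\<bar> are covered by
      \<open>c = w + 3\<close>.\<close>
    define K where "K = nat \<lceil>U + 1 - u0\<rceil>"
    have "U + 1 - u0 \<ge> 0" using U by simp
    then have K: "U + 1 \<le> u0 + real K" "real K \<le> U + c"
      unfolding K_def c_def w_def by linarith+
    \<comment> \<open>At the abscissa 2 \<sigma> - \<beta> the main term of a cell mass grows like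
      e^(\<epsilon> x), whereas the error term has a negative exponent and is largest at the
      leftmost cell; e^(2 \<open>w\<close>) absorbs the position of \<open>u0\<close>.\<close>
    have cell: "cell_mass (2 * \<sigma> - \<beta>) 1 (u0 + real m * 1) \<le> 2 * M * exp (2 * w) * exp (\<epsilon> * real m)" for m
    proof -
      define x where "x = u0 + real m * 1"
      have x: "- w \<le> x" "x \<le> w + real m" by (auto simp: x_def w_def)
      have "cell_mass (2 * \<sigma> - \<beta>) 1 x \<le> M * (1 * exp x + exp (\<beta> * x)) * exp (- ((2 * \<sigma> - \<beta>) * x))"
        unfolding M_def using \<sigma> \<delta> beta by (intro cell_mass_le) auto
      also have "\<dots> = M * (exp (\<epsilon> * x) + exp ((2 * \<sigma> - 2 * \<beta>) * - x))"
        by (simp add: \<epsilon>_def algebra_simps flip: exp_add)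
      also have "\<dots> \<le> M * (exp (2 * w) * exp (\<epsilon> * real m) + exp (2 * w) * exp (\<epsilon> * real m))"
      proof (intro mult_left_mono add_mono M)
        have "\<epsilon> * x \<le> \<epsilon> * (w + real m)" using x \<epsilon> by (intro mult_left_mono) auto
        also have "\<dots> \<le> 2 * w + \<epsilon> * real m"
          using mult_right_mono[OF \<epsilon>(2) \<open>w \<ge> 0\<close>] \<open>w \<ge> 0\<close> by (simp add: distrib_left)
        finally show "exp (\<epsilon> * x) \<le> exp (2 * w) * exp (\<epsilon> * real m)" by (simp flip: exp_add)
        have "(2 * \<sigma> - 2 * \<beta>) * - x \<le> (2 * \<sigma> - 2 * \<beta>) * w" using x \<sigma> \<delta> by (intro mult_left_mono) auto
        also have "\<dots> \<le> 2 * w" using \<sigma> beta \<open>w \<ge> 0\<close> by (intro mult_right_mono) (auto simp: field_simps)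
        also have "\<dots> \<le> 2 * w + \<epsilon> * real m" using \<epsilon> by simp
        finally show "exp ((2 * \<sigma> - 2 * \<beta>) * - x) \<le> exp (2 * w) * exp (\<epsilon> * real m)" by (simp flip: exp_add)
      qed
      finally show ?thesis by (simp add: x_def mult_ac)
    qed
    have "(\<Sum>j | u0 < lam j \<and> lam j \<le> U + 1. a j * exp ((\<beta> - 2 * \<sigma>) * lam j))
      \<le> (\<Sum>j | u0 < lam j \<and> lam j \<le> u0 + real K * 1. a j * exp (- ((2 * \<sigma> - \<beta>) * lam j)))"
      using K a_pos by (simp add: algebra_simps, intro sum_mono2 finite_cell) (auto simp: less_imp_le)
    also have "\<dots> = (\<Sum>m<K. cell_mass (2 * \<sigma> - \<beta>) 1 (u0 + real m * 1))"
      unfolding cell_mass_def by (rule sum_cells) simp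
    also have "\<dots> \<le> (\<Sum>m<K. 2 * M * exp (2 * w) * exp (\<epsilon> * real m))" by (intro sum_mono cell)
    also have "\<dots> = 2 * M * exp (2 * w) * (\<Sum>m<K. exp (\<epsilon> * real m))" by (simp add: sum_distrib_left)
    also have "\<dots> \<le> 2 * M * exp (2 * w) * ((1 + 2 * (c * exp c)) * exp_growth \<epsilon> U)"
    proof (rule mult_left_mono)
      have c0: "c \<ge> 0" using \<open>w \<ge> 0\<close> by (simp add: c_def)
      have "exp_growth \<epsilon> c \<le> c * exp (\<epsilon> * c)" using \<epsilon> by (intro exp_growth_le)
      also have "\<dots> \<le> c * exp c"
        using mult_right_mono[OF \<epsilon>(2) c0] c0 by (intro mult_left_mono) auto
      finally have c1: "exp_growth \<epsilon> c \<le> c * exp c" .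
      have "(\<Sum>m<K. exp (\<epsilon> * real m)) \<le> exp_growth \<epsilon> (real K)" using \<epsilon> by (intro sum_exp_le_exp_growth)
      also have "\<dots> \<le> exp_growth \<epsilon> (U + c)" using \<epsilon> K by (intro exp_growth_mono)
      \<comment> \<open>The overshoot \<open>c\<close> is removed by the addition formula; its cost
        e^(\<epsilon> U) is again at most twice the growth function.\<close>
      also have "\<dots> = exp_growth \<epsilon> U + exp (\<epsilon> * U) * exp_growth \<epsilon> c" by (rule exp_growth_add)
      also have "\<dots> \<le> exp_growth \<epsilon> U + (2 * exp_growth \<epsilon> U) * (c * exp c)"
        using c1 grow c0 exp_growth_ge[OF \<epsilon>(1), of c] exp_growth_ge[OF \<epsilon>(1), of U] U
        by (intro add_left_mono mult_mono) auto
      finally show "(\<Sum>m<K. exp (\<epsilon> * real m)) \<le> (1 + 2 * (c * exp c)) * exp_growth \<epsilon> U"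
        by (simp add: algebra_simps)
    qed (use M in simp)
    finally have Q: "(\<Sum>j | u0 < lam j \<and> lam j \<le> U + 1. a j * exp ((\<beta> - 2 * \<sigma>) * lam j))
       \<le> 2 * M * exp (2 * w) * ((1 + 2 * (c * exp c)) * exp_growth \<epsilon> U)" .
    have "1 / T * integral {0..T} (\<lambda>t. (cmod (F (Complex \<sigma> t) - D u0 (Complex \<sigma> t)))\<^sup>2)
       \<le> E * ((\<Sum>j | u0 < lam j \<and> lam j \<le> ln T / (1 - \<beta>) + 1. a j * exp ((\<beta> - 2 * \<sigma>) * lam j))
          + exp ((1 + \<beta> - 2 * \<sigma>) * (ln T / (1 - \<beta>))))"
      unfolding E_def
      using \<sigma> \<delta> beta T' \<kappa> pole U by (intro mean_square_remainder_le) (auto simp: U_def)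
    also have "\<dots> \<le> E * (2 * M * exp (2 * w) * ((1 + 2 * (c * exp c)) * exp_growth \<epsilon> U) + 2 * exp_growth \<epsilon> U)"
      using Q grow by (intro mult_left_mono add_mono E) (auto simp: U_def \<epsilon>_def)
    finally show "1 / T * integral {0..T} (\<lambda>t. (cmod (F (Complex \<sigma> t)))\<^sup>2)
      \<le> E * (2 * M * exp (2 * w) * (1 + 2 * (c * exp c)) + 2) * exp_growth (1 + \<beta> - 2 * \<sigma>) (ln T / (1 - \<beta>))"
      by (simp add: D_def no_terms U_def \<epsilon>_def algebra_simps)
  qed
qed

end

section \<open>The remainder bound at all real arguments, and the passage from n_j to log
  n_j\<close>

lemma counting_remainder_le:
  fixes n a :: "nat \<Rightarrow> real"
  assumes n_pos: "\<And>j. n j > 0" and n_mono: "strict_mono n" and n_unbounded: "\<not> bdd_above (range n)"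
    and a_pos: "\<And>j. a j > 0" and rho: "\<rho> > 0" and beta: "0 \<le> \<beta>" "\<beta> < 1"
    and asymp: "(\<lambda>x. counting_sum n a x - \<rho> * x) \<in> O[at_top](\<lambda>x. x powr \<beta>)"
  obtains C where "\<And>u. \<bar>counting_sum n a (exp u) - \<rho> * exp u\<bar> \<le> C * exp (\<beta> * u)"
proof -
  have fin: "finite {j. n j \<le> x}" for x
  proof -
    obtain J where "n J > x" using n_unbounded by (auto simp: bdd_above_def not_le)
    then have "j < J" if "n j \<le> x" for j
      using that strict_mono_less[OF n_mono, of j J] by simp
    then have "{j. n j \<le> x} \<subseteq> {..<J}" by auto
    then show ?thesis using finite_subset by blast
  qed
  have mono: "counting_sum n a x \<le> counting_sum n a y" if "x \<le> y" for x y
    unfolding counting_sum_def using that a_pos fin by (intro sum_mono2) (auto simp: less_imp_le)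
  have nonneg: "counting_sum n a x \<ge> 0" for x
    unfolding counting_sum_def using a_pos by (intro sum_nonneg) (auto simp: less_imp_le)
  obtain c where c: "c > 0" "\<forall>\<^sub>F x in at_top. norm (counting_sum n a x - \<rho> * x) \<le> c * norm (x powr \<beta>)"
    using asymp by (elim landau_o.bigE) auto
  then obtain X where X: "\<And>x. x \<ge> X \<Longrightarrow> \<bar>counting_sum n a x - \<rho> * x\<bar> \<le> c * (x powr \<beta>)"
    by (auto simp: eventually_at_top_linorder)
  define v where "v = ln (max X 1)"
  have v: "exp v \<ge> X" by (simp add: v_def)
  define N where "N = counting_sum n a (exp v)"
  \<comment> \<open>The first summand serves u \<ge> \<open>v\<close>. For smaller u, the second
    bounds the main term, as e^((1-\<beta>)u) \<le> e^((1-\<beta>)\<open>v\<close>). The third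
    bounds the counting sum: it vanishes below \<open>n 0\<close>, and above it e^(\<beta> u) is at
    least \<open>n 0\<close> to the power \<beta>.\<close>
  define C where "C = c + \<rho> * exp ((1 - \<beta>) * v) + N * exp (- (\<beta> * ln (n 0)))"
  have "\<bar>counting_sum n a (exp u) - \<rho> * exp u\<bar> \<le> C * exp (\<beta> * u)" for u
  proof (cases "u \<ge> v")
    case True
    then have "exp u \<ge> exp v" by simp
    then have "exp u \<ge> X" using v by linarith
    then have "\<bar>counting_sum n a (exp u) - \<rho> * exp u\<bar> \<le> c * exp (\<beta> * u)"
      using X[of "exp u"] by (simp add: powr_def)
    also have "\<dots> \<le> C * exp (\<beta> * u)"
      using rho nonneg by (intro mult_right_mono) (auto simp: C_def N_def)
    finally show ?thesis .
  next
    case False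
    have "(1 - \<beta>) * u \<le> (1 - \<beta>) * v" using False beta by (intro mult_left_mono) auto
    then have "u \<le> (1 - \<beta>) * v + \<beta> * u" by (simp add: algebra_simps)
    then have "exp u \<le> exp ((1 - \<beta>) * v) * exp (\<beta> * u)" by (simp flip: exp_add)
    then have 1: "\<rho> * exp u \<le> \<rho> * (exp ((1 - \<beta>) * v) * exp (\<beta> * u))"
      using rho by (intro mult_left_mono) auto
    have 2: "counting_sum n a (exp u) \<le> N * exp (- (\<beta> * ln (n 0))) * exp (\<beta> * u)"
    proof (cases "exp u \<ge> n 0")
      case True
      then have "ln (n 0) \<le> u" using n_pos[of 0] by (metis ln_exp ln_mono exp_gt_zero)
      then have "\<beta> * ln (n 0) \<le> \<beta> * u" using beta by (intro mult_left_mono)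
      then have "1 \<le> exp (- (\<beta> * ln (n 0))) * exp (\<beta> * u)"
        by (simp flip: exp_add)
      then have "N * 1 \<le> N * (exp (- (\<beta> * ln (n 0))) * exp (\<beta> * u))"
        unfolding N_def by (intro mult_left_mono nonneg)
      moreover have "counting_sum n a (exp u) \<le> N" unfolding N_def using \<open>\<not> u \<ge> v\<close> by (intro mono) auto
      ultimately show ?thesis by (simp add: mult.assoc)
    next
      case False
      have "n 0 \<le> n j" for j using strict_mono_less_eq[OF n_mono, of 0 j] by simp
      then have "{j. n j \<le> exp u} = {}" using False by (auto simp: not_le intro: less_le_trans)
      then show ?thesis using nonneg by (simp add: counting_sum_def N_def)
    qed
    have "0 < \<rho> * exp u" "0 < c * exp (\<beta> * u)" using rho c by auto
    then have "\<bar>counting_sum n a (exp u) - \<rho> * exp u\<bar>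
        \<le> c * exp (\<beta> * u) + \<rho> * (exp ((1 - \<beta>) * v) * exp (\<beta> * u)) + N * exp (- (\<beta> * ln (n 0))) * exp (\<beta> * u)"
      using 1 2 nonneg[of "exp u"] by linarith
    then show ?thesis by (simp add: C_def algebra_simps)
  qed
  then show ?thesis by (rule that)
qed

theorem theorem1p1:
  fixes n a :: "nat \<Rightarrow> real" and \<rho> \<beta> :: real and f :: "complex \<Rightarrow> complex"
  assumes n_pos: "\<And>j. n j > 0"
    and n_mono: "strict_mono n"
    and n_unbounded: "\<not> bdd_above (range n)"
    and a_pos: "\<And>j. a j > 0"
    and rho: "\<rho> > 0"
    and beta: "0 \<le> \<beta>" "\<beta> < 1"
    and A_asymp: "(\<lambda>x. counting_sum n a x - \<rho> * x) \<in> O[at_top](\<lambda>x. x powr \<beta>)"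
  defines "f \<equiv> dirichlet_continuation n a \<beta>"
  shows
    "(\<forall>\<sigma> > (1 + \<beta>) / 2.
        summable (\<lambda>j. (a j)\<^sup>2 / n j powr (2 * \<sigma>)) \<and>
        ((\<lambda>T. 1 / T * integral {(if \<sigma> = 1 then 1 else 0)..T} (\<lambda>t. (cmod (f (Complex \<sigma> t)))\<^sup>2))
           \<longlongrightarrow> (\<Sum>j. (a j)\<^sup>2 / n j powr (2 * \<sigma>))) at_top) \<and>
     (\<forall>\<delta> > 0. \<exists>C T\<^sub>0. \<forall>\<sigma> T. \<beta> + \<delta> \<le> \<sigma> \<longrightarrow> \<sigma> \<le> (1 + \<beta>) / 2 \<longrightarrow> T \<ge> T\<^sub>0 \<longrightarrow>
        1 / T * integral {0..T} (\<lambda>t. (cmod (f (Complex \<sigma> t)))\<^sup>2)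
          \<le> C * (if \<sigma> = (1 + \<beta>) / 2 then ln T
                 else (T powr ((1 + \<beta> - 2 * \<sigma>) / (1 - \<beta>)) - 1) / (1 + \<beta> - 2 * \<sigma>)))"
proof -
  obtain C where C: "\<And>u. \<bar>counting_sum n a (exp u) - \<rho> * exp u\<bar> \<le> C * exp (\<beta> * u)"
    using counting_remainder_le[OF n_pos n_mono n_unbounded a_pos rho beta A_asymp] by blast
  define lam where "lam j = ln (n j)" for j
  have n: "n j = exp (lam j)" for j using n_pos by (simp add: lam_def)
  interpret log_dirichlet lam a \<rho> \<beta> C
  proof
    show "strict_mono lam"
      using n_mono by (simp add: strict_mono_def n)
    show "\<not> bdd_above (range lam)"
    proof
      assume "bdd_above (range lam)"
      then obtain M where "\<And>j. lam j \<le> M" by (auto simp: bdd_above_def)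
      then have "n j \<le> exp M" for j by (simp add: n)
      then show False using n_unbounded by (auto simp: bdd_above_def)
    qed
    show "\<bar>(\<Sum>j | lam j \<le> u. a j) - \<rho> * exp u\<bar> \<le> C * exp (\<beta> * u)" for u
      using C[of u] by (simp add: counting_sum_def n)
  qed (use a_pos rho beta in auto)
  have f: "f s = F s" if "Re s > \<beta>" "s \<noteq> 1" for s
    unfolding f_def using dirichlet_continuation_eq_F[OF that] by (simp flip: n)
  have coeff: "(a j)\<^sup>2 / n j powr (2 * \<sigma>) = (a j * exp (- (\<sigma> * lam j)))\<^sup>2" for j \<sigma>
  proof -
    have "(exp (- (\<sigma> * lam j)))\<^sup>2 = exp (- (2 * \<sigma> * lam j))"
      by (simp add: power2_eq_square flip: exp_add)
    then show ?thesis
      by (simp add: n powr_def power_mult_distrib exp_minus divide_inverse)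
  qed
  show ?thesis
  proof (intro conjI allI impI)
    fix \<sigma> assume \<sigma>: "\<sigma> > (1 + \<beta>) / 2"
    show "summable (\<lambda>j. (a j)\<^sup>2 / n j powr (2 * \<sigma>))"
      unfolding coeff by (rule summable_coeff_squares[OF \<sigma>])
    have "\<sigma> > \<beta>" using \<sigma> beta by (simp add: field_simps)
    then have "f (Complex \<sigma> t) = F (Complex \<sigma> t)" if "t \<in> {(if \<sigma> = 1 then 1 else 0)..T}" for t T
      using that by (intro f) (auto simp: complex_eq_iff split: if_splits)
    then have "integral {(if \<sigma> = 1 then 1 else 0)..T} (\<lambda>t. (cmod (f (Complex \<sigma> t)))\<^sup>2)
        = integral {(if \<sigma> = 1 then 1 else 0)..T} (\<lambda>t. (cmod (F (Complex \<sigma> t)))\<^sup>2)" for T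
      by (intro integral_cong) metis
    then show "((\<lambda>T. 1 / T * integral {(if \<sigma> = 1 then 1 else 0)..T} (\<lambda>t. (cmod (f (Complex \<sigma> t)))\<^sup>2))
           \<longlongrightarrow> (\<Sum>j. (a j)\<^sup>2 / n j powr (2 * \<sigma>))) at_top"
      unfolding coeff using mean_square_limit[OF \<sigma>] by simp
  next
    fix \<delta> :: real assume \<delta>: "\<delta> > 0"
    obtain C' T0 where bound: "\<And>\<sigma> T. \<beta> + \<delta> \<le> \<sigma> \<Longrightarrow> \<sigma> \<le> (1 + \<beta>) / 2 \<Longrightarrow> T \<ge> T0 \<Longrightarrow>
      1 / T * integral {0..T} (\<lambda>t. (cmod (F (Complex \<sigma> t)))\<^sup>2) \<le> C' * exp_growth (1 + \<beta> - 2 * \<sigma>) (ln T / (1 - \<beta>))"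
      using mean_square_bound[OF \<delta>] by blast
    show "\<exists>C T\<^sub>0. \<forall>\<sigma> T. \<beta> + \<delta> \<le> \<sigma> \<longrightarrow> \<sigma> \<le> (1 + \<beta>) / 2 \<longrightarrow> T \<ge> T\<^sub>0 \<longrightarrow>
        1 / T * integral {0..T} (\<lambda>t. (cmod (f (Complex \<sigma> t)))\<^sup>2)
          \<le> C * (if \<sigma> = (1 + \<beta>) / 2 then ln T
                 else (T powr ((1 + \<beta> - 2 * \<sigma>) / (1 - \<beta>)) - 1) / (1 + \<beta> - 2 * \<sigma>))"
    \<comment> \<open>At \<sigma> = (1+\<beta>)/2 the growth function is ln T / (1-\<beta>), which
      explains the divisor; elsewhere it only enlarges the bound. T \<ge> 1 keeps the right side
      nonnegative, so that \<bar>\<open>C'\<close>\<bar> may replace \<open>C'\<close>.\<close>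
    proof (rule exI[of _ "\<bar>C'\<bar> / (1 - \<beta>)"], rule exI[of _ "max T0 1"], intro allI impI)
      fix \<sigma> T assume \<sigma>: "\<beta> + \<delta> \<le> \<sigma>" "\<sigma> \<le> (1 + \<beta>) / 2" and T: "T \<ge> max T0 1"
      define g where "g = (if \<sigma> = (1 + \<beta>) / 2 then ln T
                 else (T powr ((1 + \<beta> - 2 * \<sigma>) / (1 - \<beta>)) - 1) / (1 + \<beta> - 2 * \<sigma>))"
      have \<epsilon>: "1 + \<beta> - 2 * \<sigma> \<ge> 0" using \<sigma> by simp
      have T1: "T \<ge> 1" "T \<ge> T0" using T by auto
      have g0: "g \<ge> 0"
        unfolding g_def using T1 \<epsilon> beta by (auto intro!: divide_nonneg_nonneg ge_one_powr_ge_zero)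
      have growth: "exp_growth (1 + \<beta> - 2 * \<sigma>) (ln T / (1 - \<beta>)) \<le> g / (1 - \<beta>)"
      proof (cases "\<sigma> = (1 + \<beta>) / 2")
        case True
        then show ?thesis by (simp add: exp_growth_def g_def)
      next
        case False
        then have "exp_growth (1 + \<beta> - 2 * \<sigma>) (ln T / (1 - \<beta>)) = g"
          using T1 by (auto simp: exp_growth_def g_def powr_def)
        also have "g * (1 - \<beta>) \<le> g * 1" using g0 beta by (intro mult_left_mono) auto
        then have "g \<le> g / (1 - \<beta>)" using beta by (simp add: le_divide_eq)
        finally show ?thesis .
      qed
      have "f (Complex \<sigma> t) = F (Complex \<sigma> t)" for t
        using \<sigma> \<delta> beta by (intro f) (auto simp: complex_eq_iff)
      then have "1 / T * integral {0..T} (\<lambda>t. (cmod (f (Complex \<sigma> t)))\<^sup>2)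
          \<le> C' * exp_growth (1 + \<beta> - 2 * \<sigma>) (ln T / (1 - \<beta>))"
        using bound[OF \<sigma> T1(2)] by simp
      also have "\<dots> \<le> \<bar>C'\<bar> * (g / (1 - \<beta>))"
      proof (rule mult_mono[OF abs_ge_self growth])
        have "0 \<le> ln T / (1 - \<beta>)" using T1 beta by simp
        also have "\<dots> \<le> exp_growth (1 + \<beta> - 2 * \<sigma>) (ln T / (1 - \<beta>))" by (rule exp_growth_ge[OF \<epsilon>])
        finally show "0 \<le> exp_growth (1 + \<beta> - 2 * \<sigma>) (ln T / (1 - \<beta>))" .
      qed simp
      also have "\<dots> = \<bar>C'\<bar> / (1 - \<beta>) * g" by simp
      finally show "1 / T * integral {0..T} (\<lambda>t. (cmod (f (Complex \<sigma> t)))\<^sup>2) \<le> \<bar>C'\<bar> / (1 - \<beta>)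
          * (if \<sigma> = (1 + \<beta>) / 2 then ln T else (T powr ((1 + \<beta> - 2 * \<sigma>) / (1 - \<beta>)) - 1) / (1 + \<beta> - 2 * \<sigma>))"
        unfolding g_def .
    qed
  qed
qed

end
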